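(* Let $(V,\omega)$ be a symplectic vector space and let $\xi$ be the induced contact structure on $\mathbb{P}V$. Consider a non-trivial outer billiard reflection rule on $(\mathbb{P}V,\xi)$ which reflects $Z$ to $Z'$ over characteristic lines of tables $\Sigma\subset\mathbb{P}V$. Then the induced maps (over arbitrary tables) are local contact transformations if and only if they are given by the outer contact billiard reflection rule, i.e. the rule for which $Z,Z'$, lying on the characteristic line at a point $q\in\Sigma$, are harmonic conjugates with respect to $q,q'$.
   Context: $\mathbb{P}V$ is the space of lines through the origin in $V$; $W^\omega$ denotes the $\omega$-orthogonal complement of a subspace $W\subset V$. The contact structure $\xi$ on $\mathbb{P}V$ is given by the contact planes $\xi_q=q^\omega$. A table is a hypersurface $\Sigma\subset\mathbb{P}V$. For $q\in\Sigma$, put $q'=(T_q\Sigma)^\omega$ (the contact point of the tangent hyperplane $T_q\Sigma$, i.e. the point with $\xi_{q'}=T_q\Sigma$); when $q'\neq q$, the characteristic line at $q$ is the projective line joining $q$ and $q'$. Collinear points $C,D$ are harmonic conjugates with respect to $A,B$ if their cross ratio is $-1$, equivalently if there are lifts to $V$ with $\mathbf C=\mathbf A+\mathbf B$ and $\mathbf D=\mathbf A-\mathbf B$. An outer billiard reflection rule here is a rule assigning to a point $Z$ on a characteristic line of a table $\Sigma$ a reflected point $Z'$ on the same characteristic line; the trivial rule is $Z'=Z$. A local contact transformation is a local diffeomorphism of $\mathbb{P}V$ preserving $\xi$. *)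

theory Defs
  imports "HOL-Analysis.Analysis"
begin

section \<open>Smooth maps between Euclidean spaces\<close>

primrec Ck_on :: "nat \<Rightarrow> 'a::euclidean_space set \<Rightarrow> ('a \<Rightarrow> 'b::real_normed_vector) \<Rightarrow> bool" where
  "Ck_on 0 W f \<longleftrightarrow> continuous_on W f"
| "Ck_on (Suc k) W f \<longleftrightarrow>
     (\<forall>x\<in>W. f differentiable (at x)) \<and> (\<forall>v. Ck_on k W (\<lambda>x. frechet_derivative f (at x) v))"

text \<open>Only meaningful for open \<open>W\<close>.\<close>

definition smooth_on :: "'a::euclidean_space set \<Rightarrow> ('a \<Rightarrow> 'b::real_normed_vector) \<Rightarrow> bool" where
  "smooth_on W f \<longleftrightarrow> (\<forall>k. Ck_on k W f)"

section \<open>Symplectic vector spaces\<close>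

text \<open>A finite-dimensional real vector space is rendered as a type of class
  \<^class>\<open>euclidean_space\<close>; its inner product is used only for the topology and for derivatives.\<close>

definition symplectic_form :: "('a::euclidean_space \<Rightarrow> 'a \<Rightarrow> real) \<Rightarrow> bool" where
  "symplectic_form \<omega> \<longleftrightarrow>
     bilinear \<omega> \<and> (\<forall>v. \<omega> v v = 0) \<and> (\<forall>u. (\<forall>v. \<omega> u v = 0) \<longrightarrow> u = 0)"

definition omega_compl :: "('a::euclidean_space \<Rightarrow> 'a \<Rightarrow> real) \<Rightarrow> 'a set \<Rightarrow> 'a set" where
  "omega_compl \<omega> W = {v. \<forall>w\<in>W. \<omega> w v = 0}"

section \<open>The projective space\<close>

text \<open>Points of the projective space are lines through the origin, as subsets of \<open>V\<close>.
  Its topology and smooth structure are those of the quotient of \<open>V - {0}\<close>, so openness, smoothness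
  and hypersurfaces are expressed on \<open>V - {0}\<close> via the submersion \<open>z \<mapsto> span {z}\<close>.\<close>

definition PV :: "'a::euclidean_space set set" where
  "PV = {span {v} | v. v \<noteq> 0}"

definition cone :: "'a::euclidean_space set set \<Rightarrow> 'a set" where
  "cone U = \<Union>U - {0}"

definition proj_open :: "'a::euclidean_space set set \<Rightarrow> bool" where
  "proj_open U \<longleftrightarrow> U \<subseteq> PV \<and> open (cone U)"

text \<open>\<open>g\<close> is a smooth lift over \<open>W\<close> of the map \<open>T\<close> of the projective space; no homogeneity of \<open>g\<close> is
  required.\<close>

definition local_lift ::
  "'a::euclidean_space set \<Rightarrow> ('a \<Rightarrow> 'a) \<Rightarrow> ('a set \<Rightarrow> 'a set) \<Rightarrow> bool" where
  "local_lift W g T \<longleftrightarrow>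
     open W \<and> 0 \<notin> W \<and> smooth_on W g \<and> (\<forall>z\<in>W. g z \<noteq> 0 \<and> T (span {z}) = span {g z})"

definition proj_smooth_on ::
  "'a::euclidean_space set set \<Rightarrow> ('a set \<Rightarrow> 'a set) \<Rightarrow> bool" where
  "proj_smooth_on U T \<longleftrightarrow> (\<forall>L\<in>U. \<exists>W g. W \<inter> L \<noteq> {} \<and> local_lift W g T)"

definition local_diffeo_on ::
  "'a::euclidean_space set set \<Rightarrow> ('a set \<Rightarrow> 'a set) \<Rightarrow> bool" where
  "local_diffeo_on U T \<longleftrightarrow> proj_open U \<and>
     (\<forall>L\<in>U. \<exists>U' S. proj_open U' \<and> L \<in> U' \<and> U' \<subseteq> U \<and> proj_open (T ` U') \<and>
        proj_smooth_on U' T \<and> proj_smooth_on (T ` U') S \<and> (\<forall>M\<in>U'. S (T M) = M))"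

section \<open>Contact structure\<close>

text \<open>Subspaces of the tangent space \<open>V / q\<close> of the projective space at \<open>q\<close> are given as subspaces
  of \<open>V\<close> containing \<open>q\<close>.\<close>

definition contact_plane :: "('a::euclidean_space \<Rightarrow> 'a \<Rightarrow> real) \<Rightarrow> 'a set \<Rightarrow> 'a set" where
  "contact_plane \<omega> q = omega_compl \<omega> q"

text \<open>If \<open>g\<close> is a local lift of \<open>T\<close>, then the derivative of \<open>g\<close> at \<open>z\<close> induces the differential
  \<open>V / L \<rightarrow> V / T L\<close> of \<open>T\<close> at \<open>L = span {z}\<close>. The condition says that the preimage of the contact
  plane at \<open>T L\<close> under it is the contact plane at \<open>L\<close>; it does not depend on the lift.\<close>

definition preserves_contact ::
  "('a::euclidean_space \<Rightarrow> 'a \<Rightarrow> real) \<Rightarrow> 'a set set \<Rightarrow> ('a set \<Rightarrow> 'a set) \<Rightarrow> bool" where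
  "preserves_contact \<omega> U T \<longleftrightarrow>
     (\<forall>W g z. local_lift W g T \<and> z \<in> W \<and> span {z} \<in> U \<longrightarrow>
        (\<forall>v. frechet_derivative g (at z) v \<in> contact_plane \<omega> (T (span {z}))
             \<longleftrightarrow> v \<in> contact_plane \<omega> (span {z})))"

definition local_contact_transformation ::
  "('a::euclidean_space \<Rightarrow> 'a \<Rightarrow> real) \<Rightarrow> 'a set set \<Rightarrow> ('a set \<Rightarrow> 'a set) \<Rightarrow> bool" where
  "local_contact_transformation \<omega> U T \<longleftrightarrow> local_diffeo_on U T \<and> preserves_contact \<omega> U T"

section \<open>Tables and characteristic lines\<close>

definition smooth_hypersurface :: "'a::euclidean_space set \<Rightarrow> bool" where
  "smooth_hypersurface M \<longleftrightarrow>
     (\<forall>z\<in>M. \<exists>W (F :: 'a \<Rightarrow> real). open W \<and> z \<in> W \<and> smooth_on W F \<and>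
        (\<forall>w\<in>W. \<exists>v. frechet_derivative F (at w) v \<noteq> 0) \<and>
        M \<inter> W = {w\<in>W. F w = 0})"

definition table :: "'a::euclidean_space set set \<Rightarrow> bool" where
  "table \<Sigma> \<longleftrightarrow> \<Sigma> \<subseteq> PV \<and> smooth_hypersurface (cone \<Sigma>)"

text \<open>The tangent hyperplane at \<open>q\<close>, as a linear hyperplane of \<open>V\<close>: velocities of curves in the
  cone of the table which start at a nonzero point of \<open>q\<close>.\<close>

definition tangent_hyperplane :: "'a::euclidean_space set set \<Rightarrow> 'a set \<Rightarrow> 'a set" where
  "tangent_hyperplane \<Sigma> q =
     {v. \<exists>\<gamma> :: real \<Rightarrow> 'a. \<gamma> 0 \<in> q - {0} \<and> (\<forall>\<^sub>F t in at 0. \<gamma> t \<in> cone \<Sigma>) \<and>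
           (\<gamma> has_vector_derivative v) (at 0)}"

definition contact_point ::
  "('a::euclidean_space \<Rightarrow> 'a \<Rightarrow> real) \<Rightarrow> 'a set set \<Rightarrow> 'a set \<Rightarrow> 'a set" where
  "contact_point \<omega> \<Sigma> q = omega_compl \<omega> (tangent_hyperplane \<Sigma> q)"

definition proj_line :: "'a::euclidean_space set \<Rightarrow> 'a set \<Rightarrow> 'a set set" where
  "proj_line A B = {Z \<in> PV. Z \<subseteq> span (A \<union> B)}"

definition char_line ::
  "('a::euclidean_space \<Rightarrow> 'a \<Rightarrow> real) \<Rightarrow> 'a set set \<Rightarrow> 'a set \<Rightarrow> 'a set set" where
  "char_line \<omega> \<Sigma> q = proj_line q (contact_point \<omega> \<Sigma> q)"

text \<open>The points \<open>q\<close> and \<open>q'\<close> themselves are excluded: harmonic conjugates with respect to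
  \<open>q, q'\<close> are distinct from both, and no induced map is defined near such a point, since the
  characteristic lines do not form a smooth foliation around it.\<close>

definition reflectable ::
  "('a::euclidean_space \<Rightarrow> 'a \<Rightarrow> real) \<Rightarrow> 'a set set \<Rightarrow> 'a set \<Rightarrow> 'a set \<Rightarrow> bool" where
  "reflectable \<omega> \<Sigma> q Z \<longleftrightarrow>
     table \<Sigma> \<and> q \<in> \<Sigma> \<and> contact_point \<omega> \<Sigma> q \<noteq> q \<and>
     Z \<in> char_line \<omega> \<Sigma> q \<and> Z \<noteq> q \<and> Z \<noteq> contact_point \<omega> \<Sigma> q"

section \<open>Reflection rules\<close>

text \<open>A rule \<open>R\<close> is a single prescription for all tables: the reflected point \<open>Z' = R q q' Z\<close>
  depends on the table only through the marked points \<open>q, q'\<close> of the characteristic line, that is,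
  through the contact element of the table at \<open>q\<close>. No regularity and no invariance is assumed.\<close>

type_synonym 'a rule = "'a set \<Rightarrow> 'a set \<Rightarrow> 'a set \<Rightarrow> 'a set"

definition reflection_rule ::
  "('a::euclidean_space \<Rightarrow> 'a \<Rightarrow> real) \<Rightarrow> 'a rule \<Rightarrow> bool" where
  "reflection_rule \<omega> R \<longleftrightarrow>
     (\<forall>\<Sigma> q Z. reflectable \<omega> \<Sigma> q Z \<longrightarrow> R q (contact_point \<omega> \<Sigma> q) Z \<in> char_line \<omega> \<Sigma> q)"

definition trivial_rule ::
  "('a::euclidean_space \<Rightarrow> 'a \<Rightarrow> real) \<Rightarrow> 'a rule \<Rightarrow> bool" where
  "trivial_rule \<omega> R \<longleftrightarrow>
     (\<forall>\<Sigma> q Z. reflectable \<omega> \<Sigma> q Z \<longrightarrow> R q (contact_point \<omega> \<Sigma> q) Z = Z)"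

text \<open>\<open>C, D\<close> are harmonic conjugates with respect to \<open>A, B\<close>.\<close>

definition harmonic_conjugates ::
  "'a::euclidean_space set \<Rightarrow> 'a set \<Rightarrow> 'a set \<Rightarrow> 'a set \<Rightarrow> bool" where
  "harmonic_conjugates A B C D \<longleftrightarrow> A \<noteq> B \<and>
     (\<exists>a b. a \<noteq> 0 \<and> b \<noteq> 0 \<and> A = span {a} \<and> B = span {b} \<and>
            C = span {a + b} \<and> D = span {a - b})"

definition outer_contact_billiard_rule ::
  "('a::euclidean_space \<Rightarrow> 'a \<Rightarrow> real) \<Rightarrow> 'a rule \<Rightarrow> bool" where
  "outer_contact_billiard_rule \<omega> R \<longleftrightarrow>
     (\<forall>\<Sigma> q Z. reflectable \<omega> \<Sigma> q Z \<longrightarrow>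
        harmonic_conjugates q (contact_point \<omega> \<Sigma> q) Z (R q (contact_point \<omega> \<Sigma> q) Z))"

text \<open>Several characteristic lines of a table may pass through a point, so the induced map is
  multivalued and is considered branchwise: a branch over an open set \<open>U\<close> is fixed by choosing
  smoothly, for each \<open>Z\<close> in \<open>U\<close>, the foot \<open>p Z\<close> of a characteristic line through \<open>Z\<close>. Such a choice
  exists near \<open>Z\<close> exactly where the parametrisation of points on characteristic lines by the foot
  and the position on the line is locally a diffeomorphism.\<close>

definition foot_map ::
  "('a::euclidean_space \<Rightarrow> 'a \<Rightarrow> real) \<Rightarrow> 'a set set \<Rightarrow> 'a set set \<Rightarrow> ('a set \<Rightarrow> 'a set) \<Rightarrow> bool" where
  "foot_map \<omega> \<Sigma> U p \<longleftrightarrow>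
     proj_open U \<and> proj_smooth_on U p \<and> (\<forall>Z\<in>U. reflectable \<omega> \<Sigma> (p Z) Z)"

definition induced_map ::
  "('a::euclidean_space \<Rightarrow> 'a \<Rightarrow> real) \<Rightarrow> 'a rule \<Rightarrow> 'a set set \<Rightarrow> ('a set \<Rightarrow> 'a set) \<Rightarrow> 'a set \<Rightarrow> 'a set"
  where
  "induced_map \<omega> R \<Sigma> p Z = R (p Z) (contact_point \<omega> \<Sigma> (p Z)) Z"

end

theory Submission
  imports Defs
begin

text \<open>
  Lift a point \<open>Z\<close> of the characteristic line at \<open>q\<close> to \<open>z = a + c\<close> with \<open>a \<in> q\<close> and
  \<open>c \<in> q'\<close>. As \<open>c\<close> is \<open>\<omega>\<close>-orthogonal to the tangent hyperplane, \<open>\<omega> c (da) = \<omega> a (dc) = 0\<close>, so a lift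
  \<open>\<alpha> a + \<beta> c\<close> of the image of \<open>Z\<close> pulls the contact form \<open>\<omega> z (dz)\<close> back to
  \<open>\<alpha>\<^sup>2 \<omega> a (da) + \<beta>\<^sup>2 \<omega> c (dc)\<close>.

  For \<open>\<alpha> = 1\<close>, \<open>\<beta> = - 1\<close>, the harmonic conjugate, the contact form is preserved exactly. Hence the lift
  \<open>a - c\<close> is symplectic, and the inverse function theorem makes it a local diffeomorphism.

  Conversely, if the contact distribution is preserved and the forms \<open>\<omega> a (da)\<close> and \<open>\<omega> c (dc)\<close> are
  independent, then \<open>\<alpha> = \<beta>\<close> or \<open>\<alpha> = - \<beta>\<close>. Every isotropic pair \<open>(a, c)\<close> occurs on an explicit
  quadric table on which the forms are independent, so at each pair the rule is trivial or harmonic.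
  By continuity this alternative is constant along curves on such tables, and these connect any two pairs.
\<close>

section \<open>Calculus of smooth maps\<close>

text \<open>A rule carries no regularity, while the hypothesis speaks of maps on open sets. After
  scaling, each argument triple reads \<open>span {a}\<close>, \<open>span {b}\<close>,
  \<open>span {a + b}\<close> for an isotropic pair, so \<open>R\<close> becomes a function of pairs
  of vectors, and moving \<open>Z\<close> along its characteristic line is just a change of pair.

  To test one pair, a whole open family of characteristic lines around it must come with a smooth
  foot map. This is why the test quadric is built from a nilpotent \<open>M\<close>: the foot of x +
  t M x is recovered by a finite series and t by a square root. Completing a pair to the frame that
  defines \<open>M\<close> takes two more vectors, and nondegeneracy of \<open>\<omega>\<close>
  provides them.

  The dichotomy is pointwise and would still admit a rule that is trivial at some pairs and harmonic
  at others. What excludes this is continuity of the induced map, which comes from its being a local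
  diffeomorphism. The curves used to transport the alternative lie on test tables adapted to the two
  pairs that are to be joined, and intermediate vectors in general position remove the remaining
  special cases.\<close>

lemma Ck_on_subset: "Ck_on k W f \<Longrightarrow> W' \<subseteq> W \<Longrightarrow> Ck_on k W' f"
  by (induction k arbitrary: f) (auto intro: continuous_on_subset)

lemma Ck_on_imp_continuous_on: "Ck_on k W f \<Longrightarrow> continuous_on W f"
  by (cases k) (simp_all add: continuous_at_imp_continuous_on differentiable_imp_continuous_within)

lemma Ck_on_SucD: "Ck_on (Suc k) W f \<Longrightarrow> Ck_on k W f"
proof (induction k arbitrary: f)
  case 0
  then show ?case
    by (metis Ck_on.simps(1) Ck_on_imp_continuous_on)
next
  case (Suc k)
  then show ?case
    by (metis Ck_on.simps(2))
qed

lemma Ck_on_cong: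
  assumes "open W" "\<And>x. x \<in> W \<Longrightarrow> f x = g x" "Ck_on k W f"
  shows "Ck_on k W g"
  using assms(2,3)
proof (induction k arbitrary: f g)
  case 0
  then show ?case
    by (simp cong: continuous_on_cong)
next
  case (Suc k)
  have diff: "g differentiable (at x)" if "x \<in> W" for x
    using Suc.prems that assms(1) unfolding differentiable_def
    by (metis Ck_on.simps(2) differentiable_def has_derivative_transform_within_open)
  have "frechet_derivative f (at x) = frechet_derivative g (at x)" if "x \<in> W" for x
    using Suc.prems that assms(1) frechet_derivative_transform_within_open
    by (metis Ck_on.simps(2))
  then show ?case
    using Suc.IH[of "\<lambda>x. frechet_derivative f (at x) v" "\<lambda>x. frechet_derivative g (at x) v" for v]
      Suc.prems diff by simp
qed

text \<open>Allows a class to be checked with an explicitly known derivative in place of the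
  selected \<open>frechet_derivative\<close>; on an open set the two agree.\<close>

lemma Ck_on_SucI:
  assumes "open W" "\<And>x. x \<in> W \<Longrightarrow> (f has_derivative D x) (at x)"
    and "\<And>v. Ck_on k W (\<lambda>x. D x v)"
  shows "Ck_on (Suc k) W f"
proof -
  have "frechet_derivative f (at x) = D x" if "x \<in> W" for x
    using assms(2)[OF that] frechet_derivative_at by metis
  then have "Ck_on k W (\<lambda>x. frechet_derivative f (at x) v)" for v
    using Ck_on_cong[OF assms(1) _ assms(3)] by simp
  then show ?thesis
    using assms(2) by (auto simp: differentiable_def)
qed

lemma Ck_on_SucE:
  assumes "Ck_on (Suc k) W f"
  obtains D where "\<And>x. x \<in> W \<Longrightarrow> (f has_derivative D x) (at x)" "\<And>v. Ck_on k W (\<lambda>x. D x v)"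
  using assms that[of "\<lambda>x. frechet_derivative f (at x)"]
  by (simp add: frechet_derivative_works)

lemma Ck_on_const: "open W \<Longrightarrow> Ck_on k W (\<lambda>x. c)"
proof (induction k arbitrary: c)
  case (Suc k)
  show ?case
    by (rule Ck_on_SucI[where D = "\<lambda>x v. 0"]) (use Suc in auto)
qed auto

lemma Ck_on_bounded_linear:
  assumes "open W" "bounded_linear h" "Ck_on k W f"
  shows "Ck_on k W (\<lambda>x. h (f x))"
  using assms(3)
proof (induction k arbitrary: f)
  case 0
  then show ?case
    using assms(2) by (simp add: linear_continuous_on_compose bounded_linear.continuous_on)
next
  case (Suc k)
  then obtain D where D: "\<And>x. x \<in> W \<Longrightarrow> (f has_derivative D x) (at x)" "\<And>v. Ck_on k W (\<lambda>x. D x v)"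
    by (elim Ck_on_SucE) blast
  show ?case
    by (rule Ck_on_SucI[OF assms(1) bounded_linear.has_derivative[OF assms(2) D(1)] Suc.IH[OF D(2)]])
qed

lemma Ck_on_ident: "open W \<Longrightarrow> Ck_on k W (\<lambda>x. x)"
proof (cases k)
  case (Suc n)
  assume "open W"
  then show ?thesis
    unfolding Suc by (intro Ck_on_SucI[where D = "\<lambda>x v. v"] Ck_on_const) auto
qed auto

lemma Ck_on_add:
  assumes "open W" "Ck_on k W f" "Ck_on k W g"
  shows "Ck_on k W (\<lambda>x. f x + g x)"
  using assms(2,3)
proof (induction k arbitrary: f g)
  case 0
  then show ?case
    by (auto intro: continuous_intros)
next
  case (Suc k)
  obtain D where D: "\<And>x. x \<in> W \<Longrightarrow> (f has_derivative D x) (at x)" "\<And>v. Ck_on k W (\<lambda>x. D x v)"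
    using Suc.prems(1) by (elim Ck_on_SucE) blast
  obtain E where E: "\<And>x. x \<in> W \<Longrightarrow> (g has_derivative E x) (at x)" "\<And>v. Ck_on k W (\<lambda>x. E x v)"
    using Suc.prems(2) by (elim Ck_on_SucE) blast
  show ?case
    by (rule Ck_on_SucI[OF assms(1) has_derivative_add[OF D(1) E(1)] Suc.IH[OF D(2) E(2)]])
qed

lemma Ck_on_bounded_bilinear:
  assumes "open W" "bounded_bilinear B" "Ck_on k W f" "Ck_on k W g"
  shows "Ck_on k W (\<lambda>x. B (f x) (g x))"
  using assms(3,4)
proof (induction k arbitrary: f g)
  case 0
  then show ?case
    using bounded_bilinear.continuous_on[OF assms(2)] by auto
next
  case (Suc k)
  obtain D where D: "\<And>x. x \<in> W \<Longrightarrow> (f has_derivative D x) (at x)" "\<And>v. Ck_on k W (\<lambda>x. D x v)"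
    using Suc.prems(1) by (elim Ck_on_SucE) blast
  obtain E where E: "\<And>x. x \<in> W \<Longrightarrow> (g has_derivative E x) (at x)" "\<And>v. Ck_on k W (\<lambda>x. E x v)"
    using Suc.prems(2) by (elim Ck_on_SucE) blast
  show ?case
    by (rule Ck_on_SucI[OF assms(1) bounded_bilinear.FDERIV[OF assms(2) D(1) E(1)]
          Ck_on_add[OF assms(1) Suc.IH[OF Ck_on_SucD[OF Suc.prems(1)] E(2)]
            Suc.IH[OF D(2) Ck_on_SucD[OF Suc.prems(2)]]]])
qed

lemma Ck_on_sum:
  assumes "open W" "\<And>i. i \<in> I \<Longrightarrow> Ck_on k W (f i)"
  shows "Ck_on k W (\<lambda>x. \<Sum>i\<in>I. f i x)"
  using assms(2)
  by (induction I rule: infinite_finite_induct)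
    (auto intro!: Ck_on_const[OF assms(1)] Ck_on_add[OF assms(1)])

lemma Ck_on_inverse:
  fixes f :: "'a::euclidean_space \<Rightarrow> real"
  assumes "open W" "\<And>x. x \<in> W \<Longrightarrow> f x \<noteq> 0" "Ck_on k W f"
  shows "Ck_on k W (\<lambda>x. inverse (f x))"
  using assms(3)
proof (induction k)
  case 0
  then show ?case
    using assms(2) by (auto intro!: continuous_intros)
next
  case (Suc k)
  obtain D where D: "\<And>x. x \<in> W \<Longrightarrow> (f has_derivative D x) (at x)" "\<And>v. Ck_on k W (\<lambda>x. D x v)"
    using Suc.prems by (elim Ck_on_SucE) blast
  note IH = Suc.IH[OF Ck_on_SucD[OF Suc.prems]]
  note mult = Ck_on_bounded_bilinear[OF assms(1) bounded_bilinear_mult]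
  show ?case
  proof (rule Ck_on_SucI[OF assms(1)])
    show "((\<lambda>x. inverse (f x)) has_derivative (\<lambda>v. - (inverse (f x) * D x v * inverse (f x)))) (at x)"
      if "x \<in> W" for x
      using Deriv.has_derivative_inverse[OF assms(2)[OF that] D(1)[OF that]] .
    show "Ck_on k W (\<lambda>x. - (inverse (f x) * D x v * inverse (f x)))" for v
      by (intro Ck_on_bounded_linear[OF assms(1) bounded_linear_minus[OF bounded_linear_ident]]
          mult IH D(2))
  qed
qed

lemma Ck_on_sqrt:
  fixes f :: "'a::euclidean_space \<Rightarrow> real"
  assumes "open W" "\<And>x. x \<in> W \<Longrightarrow> f x > 0" "Ck_on k W f"
  shows "Ck_on k W (\<lambda>x. sqrt (f x))"
  using assms(3)
proof (induction k)
  case 0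
  then show ?case
    by (simp add: continuous_on_real_sqrt)
next
  case (Suc k)
  obtain D where D: "\<And>x. x \<in> W \<Longrightarrow> (f has_derivative D x) (at x)" "\<And>v. Ck_on k W (\<lambda>x. D x v)"
    using Suc.prems by (elim Ck_on_SucE) blast
  note IH = Suc.IH[OF Ck_on_SucD[OF Suc.prems]]
  note mult = Ck_on_bounded_bilinear[OF assms(1) bounded_bilinear_mult]
  show ?case
  proof (rule Ck_on_SucI[OF assms(1)])
    show "((\<lambda>x. sqrt (f x)) has_derivative (\<lambda>v. D x v * (inverse (sqrt (f x)) * (1/2)))) (at x)"
      if "x \<in> W" for x
      using has_derivative_real_sqrt[OF assms(2)[OF that] D(1)[OF that]] by (simp add: field_simps)
    show "Ck_on k W (\<lambda>x. D x v * (inverse (sqrt (f x)) * (1/2)))" for v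
      by (intro mult IH D(2) Ck_on_const Ck_on_inverse assms(1)) (use assms(2) in force)
  qed
qed

lemma has_derivative_sum_Basis:
  assumes "(f has_derivative D) (at (x::'a::euclidean_space))"
  shows "D v = (\<Sum>i\<in>Basis. (v \<bullet> i) *\<^sub>R D i)"
proof -
  have D: "linear D"
    using assms has_derivative_linear by blast
  have "D (\<Sum>i\<in>Basis. (v \<bullet> i) *\<^sub>R i) = (\<Sum>i\<in>Basis. (v \<bullet> i) *\<^sub>R D i)"
    using linear_sum[OF D, of "\<lambda>i. (v \<bullet> i) *\<^sub>R i" Basis] linear_cmul[OF D] by simp
  then show ?thesis
    by (simp only: euclidean_representation)
qed

text \<open>\<open>Ck_on\<close> controls derivatives in fixed directions only, whereas the chain
  rule evaluates the derivative of \<open>g\<close> in the moving direction \<open>D x v\<close>.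
  Expanding that direction in \<open>Basis\<close> gives a finite sum of products to which the
  induction hypothesis applies.\<close>

lemma Ck_on_compose:
  fixes f :: "'a::euclidean_space \<Rightarrow> 'b::euclidean_space" and g :: "'b \<Rightarrow> 'c::real_normed_vector"
  assumes "open W" "open V" "f ` W \<subseteq> V" "Ck_on k W f" "Ck_on k V g"
  shows "Ck_on k W (\<lambda>x. g (f x))"
  using assms(4,5)
proof (induction k arbitrary: g)
  case 0
  then show ?case
    using continuous_on_compose2[of V g W f] assms(3) by simp
next
  case (Suc k)
  obtain D where D: "\<And>x. x \<in> W \<Longrightarrow> (f has_derivative D x) (at x)" "\<And>v. Ck_on k W (\<lambda>x. D x v)"
    using Suc.prems(1) by (elim Ck_on_SucE) blast
  obtain E where E: "\<And>x. x \<in> V \<Longrightarrow> (g has_derivative E x) (at x)" "\<And>v. Ck_on k V (\<lambda>x. E x v)"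
    using Suc.prems(2) by (elim Ck_on_SucE) blast
  show ?case
  proof (rule Ck_on_SucI[OF assms(1)])
    fix x assume x: "x \<in> W"
    then have fx: "f x \<in> V"
      using assms(3) by auto
    have eq: "(\<lambda>v. E (f x) (D x v)) = (\<lambda>v. \<Sum>i\<in>Basis. (D x v \<bullet> i) *\<^sub>R E (f x) i)"
      by (rule ext, rule has_derivative_sum_Basis, rule E(1)[OF fx])
    show "((\<lambda>x. g (f x)) has_derivative (\<lambda>v. \<Sum>i\<in>Basis. (D x v \<bullet> i) *\<^sub>R E (f x) i)) (at x)"
      using has_derivative_compose[OF D(1)[OF x] E(1)[OF fx]] unfolding eq .
  next
    fix v
    show "Ck_on k W (\<lambda>x. \<Sum>i\<in>Basis. (D x v \<bullet> i) *\<^sub>R E (f x) i)"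
      by (intro Ck_on_sum assms(1) Ck_on_bounded_bilinear[OF _ bounded_bilinear_scaleR]
          Ck_on_bounded_linear[OF assms(1) bounded_linear_inner_left] D(2)
          Suc.IH[OF Ck_on_SucD[OF Suc.prems(1)] E(2)])
  qed
qed

lemma smooth_on_subset: "smooth_on W f \<Longrightarrow> W' \<subseteq> W \<Longrightarrow> smooth_on W' f"
  unfolding smooth_on_def using Ck_on_subset by blast

lemma smooth_on_imp_continuous_on: "smooth_on W f \<Longrightarrow> continuous_on W f"
  unfolding smooth_on_def using Ck_on_imp_continuous_on by blast

lemma smooth_on_has_derivative:
  "smooth_on W f \<Longrightarrow> x \<in> W \<Longrightarrow> (f has_derivative frechet_derivative f (at x)) (at x)"
  unfolding smooth_on_def by (metis Ck_on.simps(2) frechet_derivative_works)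

lemma smooth_on_frechet_derivative: "smooth_on W f \<Longrightarrow> smooth_on W (\<lambda>x. frechet_derivative f (at x) v)"
  unfolding smooth_on_def by (metis Ck_on.simps(2))

lemma smooth_on_const: "open W \<Longrightarrow> smooth_on W (\<lambda>x. c)"
  unfolding smooth_on_def by (simp add: Ck_on_const)

lemma smooth_on_ident: "open W \<Longrightarrow> smooth_on W (\<lambda>x. x)"
  unfolding smooth_on_def by (simp add: Ck_on_ident)

lemma smooth_on_bounded_linear:
  "open W \<Longrightarrow> bounded_linear h \<Longrightarrow> smooth_on W f \<Longrightarrow> smooth_on W (\<lambda>x. h (f x))"
  unfolding smooth_on_def by (simp add: Ck_on_bounded_linear)

lemma smooth_on_bounded_bilinear:
  "open W \<Longrightarrow> bounded_bilinear B \<Longrightarrow> smooth_on W f \<Longrightarrow> smooth_on W g \<Longrightarrow> smooth_on W (\<lambda>x. B (f x) (g x))"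
  unfolding smooth_on_def by (simp add: Ck_on_bounded_bilinear)

lemmas smooth_on_mult = smooth_on_bounded_bilinear[OF _ bounded_bilinear_mult]
lemmas smooth_on_scaleR = smooth_on_bounded_bilinear[OF _ bounded_bilinear_scaleR]
lemmas smooth_on_inner = smooth_on_bounded_bilinear[OF _ bounded_bilinear_inner]

lemma smooth_on_add: "open W \<Longrightarrow> smooth_on W f \<Longrightarrow> smooth_on W g \<Longrightarrow> smooth_on W (\<lambda>x. f x + g x)"
  unfolding smooth_on_def by (simp add: Ck_on_add)

lemma smooth_on_minus: "open W \<Longrightarrow> smooth_on W f \<Longrightarrow> smooth_on W (\<lambda>x. - f x)"
  by (rule smooth_on_bounded_linear[OF _ bounded_linear_minus[OF bounded_linear_ident]])

lemma smooth_on_diff: "open W \<Longrightarrow> smooth_on W f \<Longrightarrow> smooth_on W g \<Longrightarrow> smooth_on W (\<lambda>x. f x - g x)"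
  using smooth_on_add[OF _ _ smooth_on_minus] by simp

lemma smooth_on_inverse:
  fixes f :: "'a::euclidean_space \<Rightarrow> real"
  shows "open W \<Longrightarrow> (\<And>x. x \<in> W \<Longrightarrow> f x \<noteq> 0) \<Longrightarrow> smooth_on W f \<Longrightarrow> smooth_on W (\<lambda>x. inverse (f x))"
  unfolding smooth_on_def by (simp add: Ck_on_inverse)

lemma smooth_on_divide:
  fixes f :: "'a::euclidean_space \<Rightarrow> real"
  shows "open W \<Longrightarrow> (\<And>x. x \<in> W \<Longrightarrow> g x \<noteq> 0) \<Longrightarrow> smooth_on W f \<Longrightarrow> smooth_on W g \<Longrightarrow>
    smooth_on W (\<lambda>x. f x / g x)"
  by (simp add: divide_inverse smooth_on_mult smooth_on_inverse)

lemma smooth_on_sqrt: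
  fixes f :: "'a::euclidean_space \<Rightarrow> real"
  shows "open W \<Longrightarrow> (\<And>x. x \<in> W \<Longrightarrow> f x > 0) \<Longrightarrow> smooth_on W f \<Longrightarrow> smooth_on W (\<lambda>x. sqrt (f x))"
  unfolding smooth_on_def by (simp add: Ck_on_sqrt)

lemma smooth_on_compose:
  fixes f :: "'a::euclidean_space \<Rightarrow> 'b::euclidean_space"
  shows "open W \<Longrightarrow> open V \<Longrightarrow> f ` W \<subseteq> V \<Longrightarrow> smooth_on W f \<Longrightarrow> smooth_on V g \<Longrightarrow>
    smooth_on W (\<lambda>x. g (f x))"
  unfolding smooth_on_def by (simp add: Ck_on_compose)

section \<open>Symmetry of second derivatives and local inverses\<close>

lemma mixed_second_difference:
  fixes f :: "'a::real_normed_vector \<Rightarrow> real"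
  assumes r: "r > 0"
    and D: "\<And>s t. \<bar>s\<bar> \<le> r \<Longrightarrow> \<bar>t\<bar> \<le> r \<Longrightarrow>
      (f has_derivative D (x + s *\<^sub>R v + t *\<^sub>R w)) (at (x + s *\<^sub>R v + t *\<^sub>R w))"
    and E: "\<And>s t. \<bar>s\<bar> \<le> r \<Longrightarrow> \<bar>t\<bar> \<le> r \<Longrightarrow>
      ((\<lambda>y. D y v) has_derivative E (x + s *\<^sub>R v + t *\<^sub>R w)) (at (x + s *\<^sub>R v + t *\<^sub>R w))"
  shows "\<exists>s t. 0 < s \<and> s < r \<and> 0 < t \<and> t < r \<and>
    f (x + r *\<^sub>R v + r *\<^sub>R w) - f (x + r *\<^sub>R v) - f (x + r *\<^sub>R w) + f x
      = r * r * E (x + s *\<^sub>R v + t *\<^sub>R w) w"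
proof -
  have lin: "linear (D (x + s *\<^sub>R v + t *\<^sub>R w))" "linear (E (x + s *\<^sub>R v + t *\<^sub>R w))"
    if "\<bar>s\<bar> \<le> r" "\<bar>t\<bar> \<le> r" for s t
    using D[OF that] E[OF that] has_derivative_linear by auto
  define \<phi> where "\<phi> s = f (x + s *\<^sub>R v + r *\<^sub>R w) - f (x + s *\<^sub>R v)" for s
  define \<phi>' where "\<phi>' s = D (x + s *\<^sub>R v + r *\<^sub>R w) v - D (x + s *\<^sub>R v) v" for s
  have line: "((\<lambda>s. f (x + s *\<^sub>R v + t *\<^sub>R w)) has_real_derivative D (x + s *\<^sub>R v + t *\<^sub>R w) v) (at s)"
    if "\<bar>s\<bar> \<le> r" "\<bar>t\<bar> \<le> r" for s t
  proof -
    have "((\<lambda>s. x + s *\<^sub>R v + t *\<^sub>R w) has_derivative (\<lambda>h. h *\<^sub>R v)) (at s)"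
      by (auto intro!: derivative_eq_intros)
    from has_derivative_compose[OF this D[OF that]]
    show ?thesis
      using lin(1)[OF that] by (simp add: has_field_derivative_def linear_cmul mult_commute_abs)
  qed
  have "(\<phi> has_real_derivative \<phi>' s) (at s)" if "\<bar>s\<bar> \<le> r" for s
    unfolding \<phi>_def \<phi>'_def
    using DERIV_diff[OF line[of s r] line[of s 0]] that r by simp
  then obtain s where s: "0 < s" "s < r" "\<phi> r - \<phi> 0 = (r - 0) * \<phi>' s"
    using MVT2[of 0 r \<phi> \<phi>'] r by auto
  have line2: "((\<lambda>t. D (x + s *\<^sub>R v + t *\<^sub>R w) v) has_real_derivative E (x + s *\<^sub>R v + t *\<^sub>R w) w) (at t)"
    if "\<bar>t\<bar> \<le> r" for t
  proof -
    have "((\<lambda>t. x + s *\<^sub>R v + t *\<^sub>R w) has_derivative (\<lambda>h. h *\<^sub>R w)) (at t)"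
      by (auto intro!: derivative_eq_intros)
    from has_derivative_compose[OF this E[of s t]]
    show ?thesis
      using lin(2)[of s t] that s by (simp add: has_field_derivative_def linear_cmul mult_commute_abs)
  qed
  obtain t where t: "0 < t" "t < r"
      "D (x + s *\<^sub>R v + r *\<^sub>R w) v - D (x + s *\<^sub>R v + 0 *\<^sub>R w) v = (r - 0) * E (x + s *\<^sub>R v + t *\<^sub>R w) w"
    using MVT2[of 0 r "\<lambda>t. D (x + s *\<^sub>R v + t *\<^sub>R w) v" "\<lambda>t. E (x + s *\<^sub>R v + t *\<^sub>R w) w"] r line2
    by auto
  then show ?thesis
    using s unfolding \<phi>_def \<phi>'_def by (intro exI[of _ s] exI[of _ t]) auto
qed

text \<open>The mixed second difference over a small parallelogram does not depend on the order of
  its sides. Two applications of the mean value theorem turn it into either mixed derivative at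
  nearby points, and continuity lets the parallelogram shrink to \<open>x\<close>.\<close>

lemma symmetric_second_derivative_real:
  fixes f :: "'a::euclidean_space \<Rightarrow> real"
  assumes "open W" "x \<in> W"
    and D: "\<And>y. y \<in> W \<Longrightarrow> (f has_derivative D y) (at y)"
    and E: "\<And>y u. y \<in> W \<Longrightarrow> ((\<lambda>y. D y u) has_derivative E u y) (at y)"
    and cont: "\<And>u h. continuous_on W (\<lambda>y. E u y h)"
  shows "E v x w = E w x v"
proof -
  have small: "\<bar>E v x w - E w x v\<bar> \<le> 2 * e" if e: "e > 0" for e
  proof -
    have ct: "isCont (\<lambda>y. E u y h) x" for u h
      using cont assms(1,2) continuous_on_eq_continuous_at by blast
    obtain d1 where d1: "d1 > 0" "\<And>y. dist y x < d1 \<Longrightarrow> dist (E v y w) (E v x w) < e"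
      using ct[of v w, unfolded continuous_at_eps_delta, rule_format, OF e] by auto
    obtain d2 where d2: "d2 > 0" "\<And>y. dist y x < d2 \<Longrightarrow> dist (E w y v) (E w x v) < e"
      using ct[of w v, unfolded continuous_at_eps_delta, rule_format, OF e] by auto
    obtain d3 where d3: "d3 > 0" "ball x d3 \<subseteq> W"
      using assms(1,2) open_contains_ball by blast
    define d where "d = min d1 (min d2 d3)"
    define N where "N = norm v + norm w + 1"
    \<comment> \<open>The factor 2 keeps the parallelogram with sides r v and r w within distance d
      / 2 of \<open>x\<close>, hence strictly inside the ball of radius d.\<close>
    define r where "r = d / (2 * N)"
    have d: "d > 0"
      using d1 d2 d3 by (simp add: d_def)
    have pos: "N > 0"
      by (simp add: N_def add_nonneg_pos)
    have r: "r > 0"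
      using d pos by (simp add: r_def)
    have near: "dist (x + s *\<^sub>R v + t *\<^sub>R w) x < d" if "\<bar>s\<bar> \<le> r" "\<bar>t\<bar> \<le> r" for s t
    proof -
      have "norm (s *\<^sub>R v + t *\<^sub>R w) \<le> \<bar>s\<bar> * norm v + \<bar>t\<bar> * norm w"
        by (metis norm_scaleR norm_triangle_ineq)
      also have "\<dots> \<le> r * norm v + r * norm w"
        using that by (intro add_mono mult_right_mono) auto
      also have "\<dots> \<le> r * N"
        using r by (simp add: N_def algebra_simps)
      also have "\<dots> = d / 2"
        using pos by (simp add: r_def)
      finally show ?thesis
        using d by (simp add: dist_norm add.assoc)
    qed
    have inW: "x + s *\<^sub>R v + t *\<^sub>R w \<in> W" if "\<bar>s\<bar> \<le> r" "\<bar>t\<bar> \<le> r" for s t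
      using near[OF that] d3 by (auto simp: d_def dist_commute)
    obtain s t where st: "0 < s" "s < r" "0 < t" "t < r"
      "f (x + r *\<^sub>R v + r *\<^sub>R w) - f (x + r *\<^sub>R v) - f (x + r *\<^sub>R w) + f x
        = r * r * E v (x + s *\<^sub>R v + t *\<^sub>R w) w"
      using mixed_second_difference[OF r, of f D x v w "E v"] D[OF inW] E[OF inW] by blast
    have sw: "x + s *\<^sub>R w + t *\<^sub>R v = x + t *\<^sub>R v + s *\<^sub>R w" for s t
      by simp
    obtain s' t' where st': "0 < s'" "s' < r" "0 < t'" "t' < r"
      "f (x + r *\<^sub>R w + r *\<^sub>R v) - f (x + r *\<^sub>R w) - f (x + r *\<^sub>R v) + f x
        = r * r * E w (x + s' *\<^sub>R w + t' *\<^sub>R v) v"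
      using mixed_second_difference[OF r, of f D x w v "E w"] D[OF inW] E[OF inW] unfolding sw by blast
    have "r * r * E v (x + s *\<^sub>R v + t *\<^sub>R w) w = r * r * E w (x + s' *\<^sub>R w + t' *\<^sub>R v) v"
      using st(5) st'(5) by (simp add: algebra_simps)
    then have eq: "E v (x + s *\<^sub>R v + t *\<^sub>R w) w = E w (x + t' *\<^sub>R v + s' *\<^sub>R w) v"
      using r by (simp add: sw)
    have "dist (E v (x + s *\<^sub>R v + t *\<^sub>R w) w) (E v x w) < e"
      using near[of s t] st by (intro d1(2)) (auto simp: d_def)
    moreover have "dist (E w (x + t' *\<^sub>R v + s' *\<^sub>R w) v) (E w x v) < e"
      using near[of t' s'] st' by (intro d2(2)) (auto simp: d_def)
    ultimately show ?thesis
      using eq by (simp add: dist_real_def)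
  qed
  have "\<bar>E v x w - E w x v\<bar> \<le> 0 + e" if "e > 0" for e
    using small[of "e/2"] that by simp
  then have "\<bar>E v x w - E w x v\<bar> \<le> 0"
    using field_le_epsilon by blast
  then show ?thesis
    by simp
qed

lemma symmetric_second_derivative:
  fixes f :: "'a::euclidean_space \<Rightarrow> 'b::euclidean_space"
  assumes "open W" "x \<in> W" "smooth_on W f"
  shows "frechet_derivative (\<lambda>y. frechet_derivative f (at y) v) (at x) w =
    frechet_derivative (\<lambda>y. frechet_derivative f (at y) w) (at x) v"
proof (rule euclidean_eqI)
  fix i :: 'b assume "i \<in> Basis"
  have L: "bounded_linear (\<lambda>y. y \<bullet> i)"
    by (rule bounded_linear_inner_left)
  define D where "D y v = frechet_derivative f (at y) v \<bullet> i" for y v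
  define E where "E u y h = frechet_derivative (\<lambda>y. frechet_derivative f (at y) u) (at y) h \<bullet> i" for u y h
  have "E v x w = E w x v"
  proof (rule symmetric_second_derivative_real[OF assms(1,2), where D = D])
    show "((\<lambda>y. f y \<bullet> i) has_derivative D y) (at y)" if "y \<in> W" for y
      unfolding D_def using bounded_linear.has_derivative[OF L smooth_on_has_derivative[OF assms(3) that]] .
    show "((\<lambda>y. D y u) has_derivative E u y) (at y)" if "y \<in> W" for y u
      unfolding D_def E_def
      using bounded_linear.has_derivative[OF L
          smooth_on_has_derivative[OF smooth_on_frechet_derivative[OF assms(3)] that]] .
    show "continuous_on W (\<lambda>y. E u y h)" for u h
      unfolding E_def
      by (intro continuous_intros smooth_on_imp_continuous_on smooth_on_frechet_derivative assms(3))
  qed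
  then show "frechet_derivative (\<lambda>y. frechet_derivative f (at y) v) (at x) w \<bullet> i =
      frechet_derivative (\<lambda>y. frechet_derivative f (at y) w) (at x) v \<bullet> i"
    by (simp add: E_def)
qed

text \<open>The inverse function theorem takes derivatives as bounded linear maps, hence the passage
  through \<open>Blinfun\<close>; an injective linear map supplies the one-sided inverse that it
  asks for. Only the first derivative of \<open>h\<close> is recorded; its smoothness comes later,
  from symplecticity.\<close>

lemma smooth_local_inverse:
  fixes g :: "'a::euclidean_space \<Rightarrow> 'a"
  assumes "open W" "smooth_on W g" "x \<in> W" "inj (frechet_derivative g (at x))"
  obtains N V h where "open N" "N \<subseteq> W" "x \<in> N" "open V" "g x \<in> V" "homeomorphism N V g h"
    "\<And>y. y \<in> V \<Longrightarrow> (h has_derivative inv (frechet_derivative g (at (h y)))) (at y)"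
    "\<And>y. y \<in> V \<Longrightarrow> bij (frechet_derivative g (at (h y)))"
proof -
  define D where "D y = Blinfun (frechet_derivative g (at y))" for y
  have D: "blinfun_apply (D y) = frechet_derivative g (at y)" if "y \<in> W" for y
    unfolding D_def
    using bounded_linear_Blinfun_apply has_derivative_bounded_linear
      smooth_on_has_derivative[OF assms(2) that] by blast
  have "linear (D x)"
    by (simp add: blinfun.bounded_linear_right bounded_linear.linear)
  moreover have "inj (D x)"
    using assms(3,4) D by simp
  ultimately obtain i where i: "linear i" "i \<circ> D x = id"
    using linear_injective_left_inverse by blast
  have 1: "(g has_derivative D y) (at y)" if "y \<in> W" for y
    using smooth_on_has_derivative[OF assms(2) that] D[OF that] by simp
  have 2: "continuous_on W D"
  proof (rule continuous_on_blinfun_componentwise)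
    fix i :: 'a
    show "continuous_on W (\<lambda>x. D x i)"
      using smooth_on_imp_continuous_on[OF smooth_on_frechet_derivative[OF assms(2)]] D
      by (simp cong: continuous_on_cong)
  qed
  have 3: "Blinfun i o\<^sub>L D x = id_blinfun"
    using i by (intro blinfun_eqI)
      (simp add: bounded_linear_Blinfun_apply linear_conv_bounded_linear pointfree_idE)
  obtain N V h h' where NV: "open N" "N \<subseteq> W" "x \<in> N" "open V" "g x \<in> V" "homeomorphism N V g h"
    "\<And>y. y \<in> V \<Longrightarrow> (h has_derivative (h' y)) (at y)"
    "\<And>y. y \<in> V \<Longrightarrow> h' y = inv (blinfun_apply (D (h y)))"
    "\<And>y. y \<in> V \<Longrightarrow> bij (blinfun_apply (D (h y)))"
    using inverse_function_theorem[OF assms(1) 1 2 assms(3) 3] by metis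
  have "h y \<in> W" if "y \<in> V" for y
    using NV(2,6) that unfolding homeomorphism_def by blast
  then show thesis
    using NV D by (intro that[of N V h]) auto
qed

section \<open>Points of the projective space\<close>

lemma span_scaleR: "k \<noteq> 0 \<Longrightarrow> span {k *\<^sub>R a} = span {a::'a::real_vector}"
proof -
  assume "k \<noteq> 0"
  then have "a = inverse k *\<^sub>R (k *\<^sub>R a)"
    by simp
  then have "a \<in> span {k *\<^sub>R a}"
    by (metis insertI1 span_base span_scale)
  then show ?thesis
    by (simp add: span_eq span_base span_scale)
qed

lemma span_singleton_eq_iff:
  fixes a b :: "'a::real_vector"
  assumes "a \<noteq> 0"
  shows "span {a} = span {b} \<longleftrightarrow> (\<exists>k. k \<noteq> 0 \<and> b = k *\<^sub>R a)"
proof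
  assume "span {a} = span {b}"
  then have "b \<in> span {a}" "a \<in> span {b}"
    by (metis insertI1 span_base)+
  then show "\<exists>k. k \<noteq> 0 \<and> b = k *\<^sub>R a"
    using assms by (auto simp: span_singleton)
next
  assume "\<exists>k. k \<noteq> 0 \<and> b = k *\<^sub>R a"
  then show "span {a} = span {b}"
    using span_scaleR by metis
qed

lemma span_neq_combination:
  fixes a b :: "'a::real_vector"
  assumes "a \<noteq> 0" "b \<noteq> 0" "span {a} \<noteq> span {b}" "x *\<^sub>R a + y *\<^sub>R b = 0"
  shows "x = 0 \<and> y = 0"
proof -
  have "y = 0"
  proof (rule ccontr)
    assume y: "y \<noteq> 0"
    have "y *\<^sub>R b = (- x) *\<^sub>R a"
      using assms(4) by (simp add: eq_neg_iff_add_eq_0 add.commute)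
    then have "inverse y *\<^sub>R y *\<^sub>R b = inverse y *\<^sub>R (- x) *\<^sub>R a"
      by simp
    then have "b = (- x / y) *\<^sub>R a"
      using y by (simp add: divide_inverse mult.commute)
    then show False
      using assms(1-3) span_singleton_eq_iff by (metis scale_zero_left)
  qed
  then show ?thesis
    using assms by simp
qed

lemma span_combination_eq:
  fixes a b :: "'a::real_vector"
  assumes "a \<noteq> 0" "b \<noteq> 0" "span {a} \<noteq> span {b}"
    and "x *\<^sub>R a + y *\<^sub>R b = x' *\<^sub>R a + y' *\<^sub>R b"
  shows "x = x' \<and> y = y'"
  using span_neq_combination[OF assms(1-3), of "x - x'" "y - y'"] assms(4)
  by (simp add: algebra_simps)

lemma independent_pairI:
  fixes a b :: "'a::real_vector"
  assumes "a \<noteq> 0" "b \<noteq> 0" "span {a} \<noteq> span {b}"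
  shows "independent {a, b}" "a \<noteq> b"
proof -
  show "a \<noteq> b"
    using assms(3) by auto
  moreover have "a \<notin> span {b}"
  proof
    assume "a \<in> span {b}"
    then obtain k where "a = k *\<^sub>R b"
      unfolding span_singleton by blast
    then show False
      using assms span_scaleR[of k b] by (cases "k = 0") auto
  qed
  ultimately show "independent {a, b}"
    using assms(2) by (simp add: independent_insert)
qed

lemma PV_iff: "L \<in> PV \<longleftrightarrow> (\<exists>z. z \<noteq> 0 \<and> L = span {z})"
  unfolding PV_def by blast

lemma PV_eq_span: "L \<in> PV \<Longrightarrow> z \<in> L \<Longrightarrow> z \<noteq> 0 \<Longrightarrow> L = span {z}"
proof -
  assume "L \<in> PV" "z \<in> L" "z \<noteq> 0"
  then obtain w where "L = span {w}" "z \<in> span {w}"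
    unfolding PV_iff by blast
  moreover from this obtain k where "z = k *\<^sub>R w"
    unfolding span_singleton by blast
  ultimately show "L = span {z}"
    using \<open>z \<noteq> 0\<close> span_scaleR[of k w] by (cases "k = 0") auto
qed

lemma mem_cone_iff:
  assumes "U \<subseteq> PV"
  shows "z \<in> cone U \<longleftrightarrow> z \<noteq> 0 \<and> span {z} \<in> U"
proof
  assume "z \<in> cone U"
  then obtain L where "L \<in> U" "z \<in> L" "z \<noteq> 0"
    unfolding cone_def by blast
  then show "z \<noteq> 0 \<and> span {z} \<in> U"
    using PV_eq_span assms by (metis subsetD)
next
  assume "z \<noteq> 0 \<and> span {z} \<in> U"
  then show "z \<in> cone U"
    unfolding cone_def using span_base[of z "{z}"] by blast
qed

lemma cone_scaleR: "U \<subseteq> PV \<Longrightarrow> z \<in> cone U \<Longrightarrow> k \<noteq> 0 \<Longrightarrow> k *\<^sub>R z \<in> cone U"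
  by (simp add: mem_cone_iff span_scaleR)

lemma cone_span_image:
  fixes A :: "'a::euclidean_space set"
  assumes "0 \<notin> A" "\<And>x k. x \<in> A \<Longrightarrow> k \<noteq> 0 \<Longrightarrow> k *\<^sub>R x \<in> A"
  shows "cone ((\<lambda>x. span {x}) ` A) = A"
proof -
  have PV: "(\<lambda>x. span {x}) ` A \<subseteq> PV"
    using assms(1) unfolding PV_def by auto
  show ?thesis
  proof (intro equalityI subsetI)
    fix y assume "y \<in> cone ((\<lambda>x. span {x}) ` A)"
    then have "y \<noteq> 0" "span {y} \<in> (\<lambda>x. span {x}) ` A"
      using mem_cone_iff[OF PV] by auto
    then obtain x where "x \<in> A" "span {x} = span {y}"
      by auto
    then obtain k where "k \<noteq> 0" "y = k *\<^sub>R x"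
      using span_singleton_eq_iff[of x y] assms(1) by metis
    then show "y \<in> A"
      using assms(2) \<open>x \<in> A\<close> by simp
  next
    fix y assume "y \<in> A"
    then show "y \<in> cone ((\<lambda>x. span {x}) ` A)"
      using mem_cone_iff[OF PV, of y] assms(1) by auto
  qed
qed

lemma mem_proj_line:
  fixes a b :: "'a::euclidean_space"
  shows "Z \<in> proj_line (span {a}) (span {b}) \<longleftrightarrow> (\<exists>x y. x *\<^sub>R a + y *\<^sub>R b \<noteq> 0 \<and> Z = span {x *\<^sub>R a + y *\<^sub>R b})"
proof -
  have eq: "span (span {a} \<union> span {b}) = {x *\<^sub>R a + y *\<^sub>R b | x y. True}"
  proof -
    have "span (span {a} \<union> span {b}) = {u + v | u v. u \<in> span {a} \<and> v \<in> span {b}}"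
      by (simp only: span_Un span_span)
    also have "\<dots> = {x *\<^sub>R a + y *\<^sub>R b | x y. True}"
      unfolding span_singleton by blast
    finally show ?thesis .
  qed
  show ?thesis
  proof
    assume "Z \<in> proj_line (span {a}) (span {b})"
    then obtain z where z: "z \<noteq> 0" "Z = span {z}" "Z \<subseteq> span (span {a} \<union> span {b})"
      by (auto simp: proj_line_def PV_iff)
    then have "z \<in> span (span {a} \<union> span {b})"
      by (meson insertI1 span_base subsetD)
    then show "\<exists>x y. x *\<^sub>R a + y *\<^sub>R b \<noteq> 0 \<and> Z = span {x *\<^sub>R a + y *\<^sub>R b}"
      using z unfolding eq by blast
  next
    assume "\<exists>x y. x *\<^sub>R a + y *\<^sub>R b \<noteq> 0 \<and> Z = span {x *\<^sub>R a + y *\<^sub>R b}"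
    then obtain x y where xy: "x *\<^sub>R a + y *\<^sub>R b \<noteq> 0" "Z = span {x *\<^sub>R a + y *\<^sub>R b}"
      by blast
    moreover have "x *\<^sub>R a + y *\<^sub>R b \<in> span (span {a} \<union> span {b})"
      unfolding eq by blast
    ultimately show "Z \<in> proj_line (span {a}) (span {b})"
      unfolding proj_line_def PV_iff using span_minimal[of "{x *\<^sub>R a + y *\<^sub>R b}"] subspace_span by blast
  qed
qed

lemma local_lift_subset: "local_lift W g T \<Longrightarrow> open W' \<Longrightarrow> W' \<subseteq> W \<Longrightarrow> local_lift W' g T"
  unfolding local_lift_def using smooth_on_subset by blast

text \<open>Smoothness on lines provides a lift near some vector of the line. Composing with a
  homothety moves it to the representative at hand.\<close>

lemma proj_smooth_on_lift:
  assumes "proj_smooth_on U T" "span {z} \<in> U" "z \<noteq> 0"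
  obtains W g where "z \<in> W" "local_lift W g T"
proof -
  obtain W g where W: "W \<inter> span {z} \<noteq> {}" and g: "local_lift W g T"
    using assms(1,2) unfolding proj_smooth_on_def by blast
  obtain k where k: "k *\<^sub>R z \<in> W"
    using W by (auto simp: span_singleton)
  with g have k0: "k \<noteq> 0" and W: "open W"
    unfolding local_lift_def by auto
  define W' where "W' = (\<lambda>y. k *\<^sub>R y) -` W"
  have "open W'"
    unfolding W'_def by (intro open_vimage W continuous_intros)
  moreover have "smooth_on W' (\<lambda>y. g (k *\<^sub>R y))"
  proof (rule smooth_on_compose[where f = "\<lambda>y. k *\<^sub>R y" and g = g, OF \<open>open W'\<close> W])
    show "smooth_on W' (\<lambda>y. k *\<^sub>R y)"
      by (rule smooth_on_bounded_linear[OF \<open>open W'\<close> bounded_linear_scaleR_right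
            smooth_on_ident[OF \<open>open W'\<close>]])
  qed (use g in \<open>auto simp: W'_def local_lift_def\<close>)
  moreover have "g (k *\<^sub>R y) \<noteq> 0 \<and> T (span {y}) = span {g (k *\<^sub>R y)}" if "y \<in> W'" for y
  proof -
    have "k *\<^sub>R y \<in> W"
      using that by (simp add: W'_def)
    then show ?thesis
      using g span_scaleR[OF k0, of y] unfolding local_lift_def by metis
  qed
  moreover have "0 \<notin> W'"
    using g by (simp add: W'_def local_lift_def)
  ultimately have "local_lift W' (\<lambda>y. g (k *\<^sub>R y)) T"
    unfolding local_lift_def by blast
  then show thesis
    using that[of W' "\<lambda>y. g (k *\<^sub>R y)"] k by (simp add: W'_def)
qed

section \<open>Tangent hyperplanes of tables\<close>

definition defining_function :: "'a::euclidean_space set set \<Rightarrow> 'a set \<Rightarrow> ('a \<Rightarrow> real) \<Rightarrow> bool" where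
  "defining_function \<Sigma> W F \<longleftrightarrow> open W \<and> smooth_on W F \<and>
     (\<forall>w\<in>W. \<exists>v. frechet_derivative F (at w) v \<noteq> 0) \<and> cone \<Sigma> \<inter> W = {w\<in>W. F w = 0}"

lemma table_defining_function:
  assumes "table \<Sigma>" "x \<in> cone \<Sigma>"
  obtains W F where "x \<in> W" "defining_function \<Sigma> W F"
proof -
  have "\<exists>W (F :: 'a \<Rightarrow> real). open W \<and> x \<in> W \<and> smooth_on W F \<and>
      (\<forall>w\<in>W. \<exists>v. frechet_derivative F (at w) v \<noteq> 0) \<and> cone \<Sigma> \<inter> W = {w\<in>W. F w = 0}"
    using bspec[OF conjunct2[OF assms(1)[unfolded table_def smooth_hypersurface_def]] assms(2)] .
  then show thesis
    unfolding defining_function_def by (elim exE conjE) (rule that, assumption, simp add: defining_function_def)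
qed

lemma tangent_hyperplane_subset_kernel:
  assumes \<Sigma>: "\<Sigma> \<subseteq> PV" and F: "defining_function \<Sigma> W F" and x: "x \<in> cone \<Sigma>" "x \<in> W"
    and v: "v \<in> tangent_hyperplane \<Sigma> (span {x})"
  shows "frechet_derivative F (at x) v = 0"
proof -
  have DF: "(F has_derivative frechet_derivative F (at x)) (at x)"
    using F x smooth_on_has_derivative unfolding defining_function_def by blast
  obtain \<gamma> :: "real \<Rightarrow> 'a" where \<gamma>: "\<gamma> 0 \<in> span {x} - {0}" "\<forall>\<^sub>F t in at 0. \<gamma> t \<in> cone \<Sigma>"
    "(\<gamma> has_vector_derivative v) (at 0)"
    using v unfolding tangent_hyperplane_def by blast
  obtain k where k: "\<gamma> 0 = k *\<^sub>R x" "k \<noteq> 0"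
    using \<gamma>(1) by (auto simp: span_singleton)
  \<comment> \<open>A tangent curve may start at any nonzero multiple of \<open>x\<close>, but
    \<open>F\<close> is a local equation near \<open>x\<close> only. The cone is invariant under
    scaling, so the curve can be rescaled to start at \<open>x\<close>.\<close>
  define \<delta> where "\<delta> t = inverse k *\<^sub>R \<gamma> t" for t
  have \<delta>0: "\<delta> 0 = x"
    using k by (simp add: \<delta>_def)
  have d\<delta>: "(\<delta> has_derivative (\<lambda>h. h *\<^sub>R (inverse k *\<^sub>R v))) (at 0)"
    using \<gamma>(3) unfolding \<delta>_def has_vector_derivative_def
    by (auto intro!: derivative_eq_intros)
  then have "isCont \<delta> 0"
    using has_derivative_continuous by blast
  then have "\<forall>\<^sub>F t in at 0. \<delta> t \<in> W"
    using F x \<delta>0 unfolding defining_function_def isCont_def by (metis topological_tendstoD)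
  moreover have "\<forall>\<^sub>F t in at 0. \<delta> t \<in> cone \<Sigma>"
    using \<gamma>(2) by eventually_elim (auto simp: \<delta>_def k intro: cone_scaleR[OF \<Sigma>])
  ultimately have ev: "\<forall>\<^sub>F t in at 0. F (\<delta> t) = 0"
    by eventually_elim (use F in \<open>auto simp: defining_function_def\<close>)
  have F0: "F (\<delta> 0) = 0"
    using F x \<delta>0 unfolding defining_function_def by auto
  have "((\<lambda>t. F (\<delta> t)) has_derivative (\<lambda>h. frechet_derivative F (at x) (h *\<^sub>R (inverse k *\<^sub>R v)))) (at 0)"
    using has_derivative_compose[OF d\<delta>] DF \<delta>0 by simp
  then have "((\<lambda>t. 0) has_derivative (\<lambda>h. frechet_derivative F (at x) (h *\<^sub>R (inverse k *\<^sub>R v)))) (at 0)"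
    using has_derivative_transform_eventually[OF _ ev] F0 by fastforce
  then have "(\<lambda>h. frechet_derivative F (at x) (h *\<^sub>R (inverse k *\<^sub>R v))) = (\<lambda>h. 0)"
    using has_derivative_unique has_derivative_const by blast
  then have "frechet_derivative F (at x) (k *\<^sub>R (inverse k *\<^sub>R v)) = 0"
    by metis
  then show ?thesis
    using k by simp
qed

text \<open>The inverse function theorem, applied to a map which is tangent to the identity at \<open>x\<close> and has
  \<open>F\<close> as its component transverse to the kernel, yields a curve in the cone with a prescribed velocity.\<close>

lemma kernel_subset_tangent_hyperplane:
  fixes x :: "'a::euclidean_space"
  assumes F: "defining_function \<Sigma> W F" and x: "x \<in> cone \<Sigma>" "x \<in> W"
    and v: "frechet_derivative F (at x) v = 0"
  shows "v \<in> tangent_hyperplane \<Sigma> (span {x})"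
proof -
  define L where "L = frechet_derivative F (at x)"
  have DF: "(F has_derivative frechet_derivative F (at y)) (at y)" if "y \<in> W" for y
    using F that smooth_on_has_derivative unfolding defining_function_def by blast
  have L: "bounded_linear L" "linear L"
    using has_derivative_bounded_linear[OF DF[OF x(2)]] has_derivative_linear[OF DF[OF x(2)]]
    by (simp_all add: L_def)
  obtain n0 where "L n0 \<noteq> 0"
    using F x unfolding defining_function_def L_def by blast
  then obtain n where n: "L n = 1"
    using linear_cmul[OF L(2), of "1 / L n0" n0] by auto
  have W: "open W" and smF: "smooth_on W F"
    using F unfolding defining_function_def by auto
  define \<Phi> where "\<Phi> y = y - x + (F y - L (y - x)) *\<^sub>R n" for y
  have sm: "smooth_on W \<Phi>"
    unfolding \<Phi>_def
    by (intro smooth_on_add smooth_on_diff smooth_on_scaleR smooth_on_const smooth_on_ident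
        smooth_on_bounded_linear[OF W L(1)] smF W)
  have F0: "F x = 0"
    using F x unfolding defining_function_def by auto
  have "(\<Phi> has_derivative (\<lambda>h. h - 0 + (L h - L (h - 0)) *\<^sub>R n)) (at x)"
    unfolding \<Phi>_def
    by (rule derivative_eq_intros bounded_linear.has_derivative[OF L(1)] DF x refl)+
      (simp add: L_def)
  then have D: "frechet_derivative \<Phi> (at x) = (\<lambda>h. h)"
    by (simp add: frechet_derivative_at[symmetric])
  obtain N V h where NV: "open N" "N \<subseteq> W" "x \<in> N" "open V" "\<Phi> x \<in> V" "homeomorphism N V \<Phi> h"
    "\<And>y. y \<in> V \<Longrightarrow> (h has_derivative inv (frechet_derivative \<Phi> (at (h y)))) (at y)"
    using smooth_local_inverse[OF W sm x(2)] unfolding D by (metis inj_on_id2)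
  have \<Phi>0: "\<Phi> x = 0"
    by (simp add: \<Phi>_def F0 linear_0[OF L(2)])
  have hx: "h 0 = x"
    using NV(3,6) \<Phi>0 unfolding homeomorphism_def by metis
  have dh: "(h has_derivative (\<lambda>h. h)) (at 0)"
    using NV(7)[OF NV(5)] inv_id unfolding \<Phi>0 hx D id_def by simp
  have dv: "((\<lambda>t::real. t *\<^sub>R v) has_derivative (\<lambda>t. t *\<^sub>R v)) (at 0)"
    by (auto intro!: derivative_eq_intros)
  have "((\<lambda>t. h (t *\<^sub>R v)) has_derivative (\<lambda>t. t *\<^sub>R v)) (at 0)"
    using has_derivative_compose[OF dv, of h "\<lambda>h. h"] dh by simp
  then have 1: "((\<lambda>t. h (t *\<^sub>R v)) has_vector_derivative v) (at 0)"
    by (simp add: has_vector_derivative_def)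
  have "((\<lambda>t. t *\<^sub>R v) \<longlongrightarrow> 0 *\<^sub>R v) (at 0)"
    by (intro tendsto_intros)
  then have "\<forall>\<^sub>F t in at 0. t *\<^sub>R v \<in> V"
    using NV(4,5) \<Phi>0 by (metis scale_zero_left topological_tendstoD)
  then have 2: "\<forall>\<^sub>F t in at 0. h (t *\<^sub>R v) \<in> cone \<Sigma>"
  proof eventually_elim
    case (elim t)
    define y where "y = h (t *\<^sub>R v)"
    have y: "y \<in> W" "\<Phi> y = t *\<^sub>R v"
      using NV(2,6) elim unfolding homeomorphism_def y_def by auto
    have "L (\<Phi> y) = L (y - x) + (F y - L (y - x)) * L n"
      unfolding \<Phi>_def by (simp add: linear_add[OF L(2)] linear_cmul[OF L(2)])
    moreover have "L (\<Phi> y) = 0"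
      using v linear_cmul[OF L(2), of t v] by (simp add: y(2) L_def)
    ultimately have "F y = 0"
      using n by simp
    then show ?case
      using F y(1) unfolding defining_function_def y_def by auto
  qed
  have 3: "h (0 *\<^sub>R v) \<in> span {x} - {0}"
    using hx x(1) span_base[of x "{x}"] by (auto simp: cone_def)
  show ?thesis
    unfolding tangent_hyperplane_def
    using 1 2 3 by (intro CollectI exI[of _ "\<lambda>t. h (t *\<^sub>R v)"]) blast
qed

lemma tangent_hyperplane_eq_kernel:
  assumes "\<Sigma> \<subseteq> PV" "defining_function \<Sigma> W F" "x \<in> cone \<Sigma>" "x \<in> W"
  shows "tangent_hyperplane \<Sigma> (span {x}) = {v. frechet_derivative F (at x) v = 0}"
  using tangent_hyperplane_subset_kernel[OF assms] kernel_subset_tangent_hyperplane[OF assms(2-4)]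
  by blast

text \<open>The ray through \<open>x\<close> stays in the cone, so its direction is tangent. This is
  what places q inside its own tangent hyperplane and makes characteristic lines isotropic.\<close>

lemma defining_function_radial:
  assumes "\<Sigma> \<subseteq> PV" "defining_function \<Sigma> W F" "x \<in> cone \<Sigma>" "x \<in> W"
  shows "frechet_derivative F (at x) x = 0"
proof (rule tangent_hyperplane_subset_kernel[OF assms])
  have x0: "x \<noteq> 0"
    using assms(3) by (simp add: cone_def)
  have "((\<lambda>t. (1 + t) *\<^sub>R x) has_vector_derivative x) (at 0)"
    unfolding has_vector_derivative_def by (auto intro!: derivative_eq_intros)
  moreover have "\<forall>\<^sub>F t in at 0. (1 + t) *\<^sub>R x \<in> cone \<Sigma>"
  proof -
    have "((\<lambda>t::real. 1 + t) \<longlongrightarrow> 1 + 0) (at 0)"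
      by (intro tendsto_intros)
    then have "\<forall>\<^sub>F t in at 0. (1::real) + t \<noteq> 0"
      by (intro tendsto_imp_eventually_ne) auto
    then show ?thesis
      by eventually_elim (rule cone_scaleR[OF assms(1,3)])
  qed
  moreover have "(1 + 0) *\<^sub>R x \<in> span {x} - {0}"
    using x0 by (simp add: span_base)
  ultimately show "x \<in> tangent_hyperplane \<Sigma> (span {x})"
    unfolding tangent_hyperplane_def by (intro CollectI exI[of _ "\<lambda>t. (1 + t) *\<^sub>R x"]) blast
qed

section \<open>Symplectic forms\<close>

locale symplectic_space =
  fixes \<omega> :: "'a::euclidean_space \<Rightarrow> 'a \<Rightarrow> real"
  assumes symplectic: "symplectic_form \<omega>"
begin

sublocale bounded_bilinear \<omega>
  using symplectic by (simp add: symplectic_form_def bilinear_conv_bounded_bilinear)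

declare zero_left [simp] zero_right [simp]

lemmas \<omega>_simps = add_left add_right scaleR_left scaleR_right diff_left diff_right
  minus_left minus_right zero_left zero_right

lemma self [simp]: "\<omega> v v = 0"
  using symplectic by (simp add: symplectic_form_def)

lemma skew: "\<omega> u v = - \<omega> v u"
proof -
  have "\<omega> (u + v) (u + v) = \<omega> u u + \<omega> u v + (\<omega> v u + \<omega> v v)"
    by (simp only: add_left add_right)
  then show ?thesis
    by simp
qed

lemma nondegenerate: "(\<And>v. \<omega> u v = 0) \<Longrightarrow> u = 0"
  using symplectic by (simp add: symplectic_form_def)

lemma ex_sharp: "\<exists>J. linear J \<and> (\<forall>u v. \<omega> (J u) v = u \<bullet> v)"
proof -
  define A where "A u = (\<Sum>i\<in>Basis. \<omega> u i *\<^sub>R i)" for u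
  have A: "A u \<bullet> v = \<omega> u v" for u v
  proof -
    have "\<omega> u v = \<omega> u (\<Sum>i\<in>Basis. (v \<bullet> i) *\<^sub>R i)"
      by (simp only: euclidean_representation)
    also have "\<dots> = A u \<bullet> v"
      unfolding A_def inner_sum_left sum_right scaleR_right inner_scaleR_left
      by (simp add: inner_commute mult.commute)
    finally show ?thesis
      by simp
  qed
  have "linear A"
    unfolding A_def by (auto intro!: linearI simp: \<omega>_simps scaleR_add_left sum.distrib scaleR_sum_right)
  moreover have "inj A"
  proof (rule linear_injective_0[OF \<open>linear A\<close>, THEN iffD2], intro allI impI)
    fix u assume "A u = 0"
    then have "\<omega> u v = 0" for v
      using A[of u v] by simp
    then show "u = 0"
      by (rule nondegenerate)
  qed
  ultimately obtain J where "linear J" "\<And>u. A (J u) = u"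
    using linear_injective_isomorphism[of A] by metis
  then show ?thesis
    using A by metis
qed

definition sharp :: "'a \<Rightarrow> 'a" where
  "sharp = (SOME J. linear J \<and> (\<forall>u v. \<omega> (J u) v = u \<bullet> v))"

lemma linear_sharp: "linear sharp" and sharp: "\<omega> (sharp u) v = u \<bullet> v"
  using someI_ex[OF ex_sharp] unfolding sharp_def by auto

text \<open>Built from the values of the functional on \<open>Basis\<close> alone, so that smooth
  dependence of the representing vector reduces to smooth dependence of finitely many
  numbers.\<close>

definition represent :: "('a \<Rightarrow> real) \<Rightarrow> 'a" where
  "represent \<phi> = sharp (\<Sum>i\<in>Basis. \<phi> i *\<^sub>R i)"

lemma represent:
  assumes "linear \<phi>"
  shows "\<omega> (represent \<phi>) v = \<phi> v"
proof -
  have "\<omega> (represent \<phi>) v = (\<Sum>i\<in>Basis. (v \<bullet> i) * \<phi> i)"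
    unfolding represent_def sharp inner_sum_left inner_scaleR_left
    by (simp add: inner_commute mult.commute)
  also have "\<dots> = \<phi> (\<Sum>i\<in>Basis. (v \<bullet> i) *\<^sub>R i)"
    using assms by (simp add: linear_sum linear_cmul)
  finally show ?thesis
    by (simp add: euclidean_representation)
qed

lemma Ck_on_represent:
  assumes "open W" "\<And>i. Ck_on k W (\<lambda>x. \<phi> x i)"
  shows "Ck_on k W (\<lambda>x. represent (\<phi> x))"
  unfolding represent_def
  by (intro Ck_on_bounded_linear[OF assms(1) linear_conv_bounded_linear[THEN iffD1, OF linear_sharp]]
      Ck_on_sum Ck_on_bounded_bilinear[OF _ bounded_bilinear_scaleR] Ck_on_const assms)

lemma smooth_on_represent:
  "open W \<Longrightarrow> (\<And>i. smooth_on W (\<lambda>x. \<phi> x i)) \<Longrightarrow> smooth_on W (\<lambda>x. represent (\<phi> x))"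
  unfolding smooth_on_def by (simp add: Ck_on_represent)

text \<open>Source of the frame vectors: a functional prescribed on an independent set extends
  linearly and is represented through \<open>\<omega>\<close>. The minus sign in the witness moves
  the pairing to the right-hand slot.\<close>

lemma ex_prescribed:
  assumes "independent B"
  shows "\<exists>v. \<forall>x\<in>B. \<omega> x v = f x"
proof -
  obtain g :: "'a \<Rightarrow> real" where g: "linear g" "\<forall>x\<in>B. g x = f x"
    using linear_independent_extend[OF assms] by blast
  then have "\<forall>x\<in>B. \<omega> x (- represent g) = f x"
    using represent[OF g(1)] by (simp add: minus_right skew[of _ "represent g"])
  then show ?thesis
    by blast
qed

lemma omega_compl_kernel:
  assumes "linear \<phi>" "\<phi> n \<noteq> 0"
  shows "omega_compl \<omega> {v. \<phi> v = 0} = span {represent \<phi>}"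
proof (intro equalityI subsetI)
  fix u assume "u \<in> omega_compl \<omega> {v. \<phi> v = 0}"
  then have u: "\<omega> w u = 0" if "\<phi> w = 0" for w
    using that by (simp add: omega_compl_def)
  \<comment> \<open>With this factor the functional paired with u - k
    \<open>represent \<phi>\<close> vanishes at \<open>n\<close> as well as on the kernel of
    \<open>\<phi>\<close>, hence everywhere.\<close>
  define k where "k = \<omega> u n / \<phi> n"
  have "\<omega> (u - k *\<^sub>R represent \<phi>) v = 0" for v
  proof -
    have "\<phi> (v - (\<phi> v / \<phi> n) *\<^sub>R n) = 0"
      using assms by (simp add: linear_diff linear_cmul)
    then have "\<omega> (v - (\<phi> v / \<phi> n) *\<^sub>R n) u = 0"
      by (rule u)
    then have "\<omega> u v = \<phi> v / \<phi> n * \<omega> u n"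
      using skew[of u v] skew[of u n] by (simp add: \<omega>_simps)
    then show ?thesis
      by (simp add: \<omega>_simps represent[OF assms(1)] k_def)
  qed
  then have "u - k *\<^sub>R represent \<phi> = 0"
    by (rule nondegenerate)
  then show "u \<in> span {represent \<phi>}"
    by (auto simp: span_singleton)
next
  fix u assume "u \<in> span {represent \<phi>}"
  then obtain k where "u = k *\<^sub>R represent \<phi>"
    by (auto simp: span_singleton)
  then show "u \<in> omega_compl \<omega> {v. \<phi> v = 0}"
    using represent[OF assms(1)] by (auto simp: omega_compl_def \<omega>_simps skew[of _ "represent \<phi>"])
qed

lemma mem_contact_plane: "v \<in> contact_plane \<omega> (span {z}) \<longleftrightarrow> \<omega> z v = 0"
  by (auto simp: contact_plane_def omega_compl_def span_singleton \<omega>_simps)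

text \<open>Up to sign convention, the Hamiltonian vector of \<open>F\<close> at \<open>x\<close>.
  On the cone it is a lift of the contact point that varies smoothly with \<open>x\<close>.\<close>

definition conormal :: "('a \<Rightarrow> real) \<Rightarrow> 'a \<Rightarrow> 'a" where
  "conormal F x = represent (frechet_derivative F (at x))"

lemma conormal:
  assumes "defining_function \<Sigma> W F" "x \<in> W"
  shows "\<omega> (conormal F x) v = frechet_derivative F (at x) v"
  unfolding conormal_def
  using assms unfolding defining_function_def
  by (intro represent has_derivative_linear[OF smooth_on_has_derivative]) auto

lemma smooth_on_conormal:
  assumes "defining_function \<Sigma> W F"
  shows "smooth_on W (conormal F)"
  unfolding conormal_def
  using assms unfolding defining_function_def
  by (intro smooth_on_represent smooth_on_frechet_derivative) auto

lemma contact_point_eq_conormal: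
  assumes "\<Sigma> \<subseteq> PV" "defining_function \<Sigma> W F" "x \<in> cone \<Sigma>" "x \<in> W"
  shows "contact_point \<omega> \<Sigma> (span {x}) = span {conormal F x}"
    and "conormal F x \<noteq> 0" and "\<omega> x (conormal F x) = 0"
proof -
  obtain n where n: "frechet_derivative F (at x) n \<noteq> 0"
    using assms unfolding defining_function_def by blast
  have "linear (frechet_derivative F (at x))"
    using has_derivative_linear[OF smooth_on_has_derivative[of W F, OF _ assms(4)]] assms(2)
    unfolding defining_function_def by blast
  then show "contact_point \<omega> \<Sigma> (span {x}) = span {conormal F x}"
    unfolding contact_point_def tangent_hyperplane_eq_kernel[OF assms] conormal_def
    using n by (rule omega_compl_kernel)
  show "conormal F x \<noteq> 0"
    using conormal[OF assms(2,4), of n] n by auto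
  show "\<omega> x (conormal F x) = 0"
    using conormal[OF assms(2,4), of x] defining_function_radial[OF assms] skew[of x] by simp
qed

definition isotropic_pair :: "'a \<Rightarrow> 'a \<Rightarrow> bool" where
  "isotropic_pair a b \<longleftrightarrow> \<omega> a b = 0 \<and> a \<noteq> 0 \<and> b \<noteq> 0 \<and> span {a} \<noteq> span {b}"

text \<open>As \<open>Z\<close> differs from both marked points, both of its coefficients are
  nonzero and can be absorbed into the lifts. The triple (q, q', Z) is thereby encoded by two
  vectors.\<close>

lemma reflectable_lifts:
  assumes "reflectable \<omega> \<Sigma> q Z"
  obtains a b where "isotropic_pair a b" "q = span {a}" "contact_point \<omega> \<Sigma> q = span {b}"
    "Z = span {a + b}"
proof -
  have r: "table \<Sigma>" "q \<in> \<Sigma>" "contact_point \<omega> \<Sigma> q \<noteq> q" "Z \<in> char_line \<omega> \<Sigma> q" "Z \<noteq> q"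
    "Z \<noteq> contact_point \<omega> \<Sigma> q"
    using assms unfolding reflectable_def by auto
  have \<Sigma>: "\<Sigma> \<subseteq> PV"
    using r(1) by (simp add: table_def)
  then obtain x where x: "x \<noteq> 0" "q = span {x}"
    using r(2) PV_iff by blast
  then have xc: "x \<in> cone \<Sigma>"
    using r(2) \<Sigma> by (simp add: mem_cone_iff)
  obtain W F where F: "x \<in> W" "defining_function \<Sigma> W F"
    using table_defining_function[OF r(1) xc] .
  define y where "y = conormal F x"
  note y = contact_point_eq_conormal[OF \<Sigma> F(2) xc F(1), folded y_def x(2)]
  obtain s t where st: "s *\<^sub>R x + t *\<^sub>R y \<noteq> 0" "Z = span {s *\<^sub>R x + t *\<^sub>R y}"
    using r(4) unfolding char_line_def y(1) unfolding x(2) mem_proj_line by blast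
  have s: "s \<noteq> 0"
  proof
    assume "s = 0"
    then have "t \<noteq> 0" "Z = span {t *\<^sub>R y}"
      using st by auto
    then show False
      using r(6) y(1) span_scaleR by metis
  qed
  have t: "t \<noteq> 0"
  proof
    assume "t = 0"
    then have "Z = span {s *\<^sub>R x}"
      using st by auto
    then show False
      using r(5) x(2) s span_scaleR by metis
  qed
  show thesis
  proof (rule that[of "s *\<^sub>R x" "t *\<^sub>R y"])
    show "isotropic_pair (s *\<^sub>R x) (t *\<^sub>R y)"
      using s t x(1) y r(3) unfolding isotropic_pair_def
      by (simp add: \<omega>_simps span_scaleR x(2)[symmetric])
  qed (use s t st x y in \<open>simp_all add: span_scaleR\<close>)
qed

end

section \<open>The outer contact billiard rule\<close>

text \<open>Cramer's rule for the Gram matrix: the coefficient of \<open>z\<close> along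
  \<open>a\<close> is a quotient of inner products, so it is smooth whenever \<open>a\<close>,
  \<open>b\<close> and \<open>z\<close> are.\<close>

lemma gram_coefficient:
  fixes a b z :: "'a::real_inner"
  assumes "a \<noteq> 0" "b \<noteq> 0" "span {a} \<noteq> span {b}"
  shows "(a \<bullet> a) * (b \<bullet> b) - (a \<bullet> b) * (a \<bullet> b) \<noteq> 0"
    and "z = x *\<^sub>R a + y *\<^sub>R b \<Longrightarrow>
      x = ((z \<bullet> a) * (b \<bullet> b) - (z \<bullet> b) * (a \<bullet> b)) / ((a \<bullet> a) * (b \<bullet> b) - (a \<bullet> b) * (a \<bullet> b))"
proof -
  \<comment> \<open>A multiple of the component of \<open>a\<close> orthogonal to \<open>b\<close>;
    its squared norm is \<open>b \<bullet> b\<close> times the Gram determinant.\<close>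
  define u where "u = (b \<bullet> b) *\<^sub>R a + (- (a \<bullet> b)) *\<^sub>R b"
  have "u \<bullet> u = (b \<bullet> b) * ((a \<bullet> a) * (b \<bullet> b) - (a \<bullet> b) * (a \<bullet> b))"
    unfolding u_def by (simp add: inner_add_left inner_add_right inner_commute[of b a] algebra_simps)
  moreover have "u \<noteq> 0"
    using span_neq_combination[OF assms, of "b \<bullet> b"] assms(2) unfolding u_def by fastforce
  ultimately show 1: "(a \<bullet> a) * (b \<bullet> b) - (a \<bullet> b) * (a \<bullet> b) \<noteq> 0"
    by (metis inner_eq_zero_iff mult_zero_right)
  show "x = ((z \<bullet> a) * (b \<bullet> b) - (z \<bullet> b) * (a \<bullet> b)) / ((a \<bullet> a) * (b \<bullet> b) - (a \<bullet> b) * (a \<bullet> b))"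
    if "z = x *\<^sub>R a + y *\<^sub>R b"
  proof -
    have "(z \<bullet> a) * (b \<bullet> b) - (z \<bullet> b) * (a \<bullet> b) = x * ((a \<bullet> a) * (b \<bullet> b) - (a \<bullet> b) * (a \<bullet> b))"
      unfolding that by (simp add: inner_add_left inner_commute[of b a] algebra_simps)
    then show ?thesis
      using 1 by simp
  qed
qed

lemma proj_open_span_image:
  fixes B :: "'a::euclidean_space set"
  assumes "open B" "0 \<notin> B"
  shows "proj_open ((\<lambda>z. span {z}) ` B)"
proof -
  have PV: "(\<lambda>z. span {z}) ` B \<subseteq> PV"
    using assms(2) unfolding PV_def by auto
  have "cone ((\<lambda>z. span {z}) ` B) = (\<Union>k\<in>-{0}. (\<lambda>z. k *\<^sub>R z) ` B)"
  proof (intro equalityI subsetI)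
    fix y assume "y \<in> cone ((\<lambda>z. span {z}) ` B)"
    then obtain z where z: "y \<noteq> 0" "z \<in> B" "y \<in> span {z}"
      unfolding cone_def by blast
    then obtain k where "y = k *\<^sub>R z"
      unfolding span_singleton by blast
    with z show "y \<in> (\<Union>k\<in>-{0}. (\<lambda>z. k *\<^sub>R z) ` B)"
      by (cases "k = 0") auto
  next
    fix y assume "y \<in> (\<Union>k\<in>-{0}. (\<lambda>z. k *\<^sub>R z) ` B)"
    then obtain k z where "k \<noteq> 0" "z \<in> B" "y = k *\<^sub>R z"
      by auto
    moreover have "k *\<^sub>R z \<in> span {z}"
      by (simp add: span_base span_scale)
    ultimately show "y \<in> cone ((\<lambda>z. span {z}) ` B)"
      using assms(2) unfolding cone_def by auto
  qed
  moreover have "open (\<Union>k\<in>-{0::real}. (\<lambda>z. k *\<^sub>R z) ` B)"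
    by (intro open_UN ballI open_scaling assms(1)) auto
  ultimately show ?thesis
    unfolding proj_open_def using PV by simp
qed

section \<open>Lifts preserving the contact form and their inverses\<close>

context symplectic_space
begin

text \<open>The form \<open>\<omega> z\<close> (dz) is a primitive of twice \<open>\<omega>\<close>,
  and exterior differentiation commutes with pullback. Concretely: differentiate the hypothesis in
  direction \<open>u\<close>, exchange \<open>u\<close> and \<open>v\<close>, and subtract; the
  second derivatives of \<open>g\<close> cancel by symmetry.\<close>

lemma derivative_symplectic:
  assumes "open W" "smooth_on W g"
    and form: "\<And>z v. z \<in> W \<Longrightarrow> \<omega> (g z) (frechet_derivative g (at z) v) = \<omega> z v"
    and z: "z \<in> W"
  shows "\<omega> (frechet_derivative g (at z) u) (frechet_derivative g (at z) v) = \<omega> u v"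
proof -
  define D where "D u y = frechet_derivative g (at y) u" for u y
  define D2 where "D2 u v = frechet_derivative (D u) (at z) v" for u v
  have eq: "\<omega> (g z) (D2 v u) + \<omega> (D u z) (D v z) = \<omega> u v" for u v
  proof -
    have "(g has_derivative (\<lambda>u. D u z)) (at z)"
      using smooth_on_has_derivative[OF assms(2) z] unfolding D_def .
    moreover have "(D v has_derivative D2 v) (at z)"
      using smooth_on_has_derivative[OF smooth_on_frechet_derivative[OF assms(2)] z]
      unfolding D_def D2_def .
    ultimately have "((\<lambda>y. \<omega> (g y) (D v y)) has_derivative (\<lambda>u. \<omega> (g z) (D2 v u) + \<omega> (D u z) (D v z))) (at z)"
      by (rule FDERIV)
    then have "((\<lambda>y. \<omega> y v) has_derivative (\<lambda>u. \<omega> (g z) (D2 v u) + \<omega> (D u z) (D v z))) (at z)"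
      by (rule has_derivative_transform_within_open[OF _ assms(1) z]) (simp add: D_def form)
    moreover have "((\<lambda>y. \<omega> y v) has_derivative (\<lambda>u. \<omega> u v)) (at z)"
      by (rule bounded_linear_imp_has_derivative[OF bounded_linear_left])
    ultimately show ?thesis
      using has_derivative_unique by metis
  qed
  have "D2 v u = D2 u v"
    unfolding D2_def D_def by (rule symmetric_second_derivative[OF assms(1) z assms(2)])
  then have "\<omega> (D u z) (D v z) - \<omega> (D v z) (D u z) = \<omega> u v - \<omega> v u"
    using eq[of v u] eq[of u v] by simp
  then show ?thesis
    using skew[of v u] skew[of "D v z" "D u z"] unfolding D_def by simp
qed

text \<open>The inverse of a symplectic linear map is its adjoint with respect to \<open>\<omega>\<close>, so no smoothness
  of matrix inversion is needed.\<close>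

lemma smooth_on_symplectic_inverse:
  assumes "open N" "open V" "smooth_on N g" "homeomorphism N V g h"
    and dh: "\<And>y. y \<in> V \<Longrightarrow> (h has_derivative inv (frechet_derivative g (at (h y)))) (at y)"
    and bij: "\<And>y. y \<in> V \<Longrightarrow> bij (frechet_derivative g (at (h y)))"
    and sympl: "\<And>z u v. z \<in> N \<Longrightarrow>
      \<omega> (frechet_derivative g (at z) u) (frechet_derivative g (at z) v) = \<omega> u v"
  shows "smooth_on V h"
proof -
  define D where "D z u = frechet_derivative g (at z) u" for z u
  have hN: "h y \<in> N" if "y \<in> V" for y
    using assms(4) that unfolding homeomorphism_def by blast
  have inv: "inv (D (h y)) v = represent (\<lambda>i. \<omega> v (D (h y) i))" if y: "y \<in> V" for y v
  proof -
    have lin: "linear (D (h y))"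
      using has_derivative_linear[OF smooth_on_has_derivative[OF assms(3) hN[OF y]]]
      unfolding D_def .
    have "linear (\<lambda>i. \<omega> v (D (h y) i))"
      using lin by (auto intro!: linearI simp: linear_add linear_cmul add_right scaleR_right)
    note rep = represent[OF this]
    have "D (h y) (inv (D (h y)) v) = v"
      using bij[OF y] unfolding D_def by (simp add: bij_is_surj surj_f_inv_f)
    then have "\<omega> (inv (D (h y)) v) w = \<omega> v (D (h y) w)" for w
      using sympl[OF hN[OF y], of "inv (D (h y)) v" w] unfolding D_def by simp
    then have "\<omega> (inv (D (h y)) v - represent (\<lambda>i. \<omega> v (D (h y) i))) w = 0" for w
      by (simp add: diff_left rep)
    then show ?thesis
      using nondegenerate by force
  qed
  \<comment> \<open>Bootstrapping: the derivative of \<open>h\<close> at \<open>y\<close> is an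
    expression in the derivative of \<open>g\<close> at \<open>h y\<close>, so each class gained for
    \<open>h\<close> passes to its derivative.\<close>
  have "Ck_on k V h" for k
  proof (induction k)
    case 0
    then show ?case
      using assms(4) by (simp add: homeomorphism_def)
  next
    case (Suc k)
    show ?case
    proof (rule Ck_on_SucI[OF assms(2)])
      show "(h has_derivative (\<lambda>v. represent (\<lambda>i. \<omega> v (D (h y) i)))) (at y)" if "y \<in> V" for y
        using dh[OF that] inv[OF that] unfolding D_def by (metis (no_types, lifting) ext)
      fix v
      have "Ck_on k V (\<lambda>y. D (h y) i)" for i
      proof (rule Ck_on_compose[where f = h and g = "\<lambda>z. D z i", OF assms(2,1) _ Suc])
        show "Ck_on k N (\<lambda>z. D z i)"
          using smooth_on_frechet_derivative[OF assms(3)] unfolding D_def smooth_on_def by blast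
      qed (use hN in blast)
      then show "Ck_on k V (\<lambda>y. represent (\<lambda>i. \<omega> v (D (h y) i)))"
        by (intro Ck_on_represent[OF assms(2)]
            Ck_on_bounded_linear[where h = "\<omega> v", OF assms(2) bounded_linear_right])
    qed
  qed
  then show ?thesis
    by (simp add: smooth_on_def)
qed

section \<open>Splitting a lift along the characteristic line\<close>

lemma isotropic_decomposition_unique:
  assumes "isotropic_pair a c" "span {a} = span {a'}" "span {c} = span {c'}" "a + c = a' + c'"
  shows "a' = a" "c' = c"
proof -
  have ac: "a \<noteq> 0" "c \<noteq> 0" "span {a} \<noteq> span {c}"
    using assms(1) by (auto simp: isotropic_pair_def)
  obtain k l where kl: "a' = k *\<^sub>R a" "c' = l *\<^sub>R c"
    using assms(2,3) ac span_singleton_eq_iff by metis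
  then have "1 *\<^sub>R a + 1 *\<^sub>R c = k *\<^sub>R a + l *\<^sub>R c"
    using assms(4) by simp
  then have "1 = k \<and> 1 = l"
    by (rule span_combination_eq[OF ac])
  then show "a' = a" "c' = c"
    using kl by auto
qed

text \<open>The last condition says that the lift \<open>a\<close> of the foot moves tangentially to the table.\<close>

definition decomposition ::
  "'a set set \<Rightarrow> ('a set \<Rightarrow> 'a set) \<Rightarrow> 'a set \<Rightarrow> ('a \<Rightarrow> 'a) \<Rightarrow> ('a \<Rightarrow> 'a) \<Rightarrow> bool" where
  "decomposition \<Sigma> p N a c \<longleftrightarrow> open N \<and> smooth_on N a \<and> smooth_on N c \<and>
     (\<forall>z\<in>N. z = a z + c z \<and> isotropic_pair (a z) (c z) \<and> p (span {z}) = span {a z} \<and>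
        contact_point \<omega> \<Sigma> (p (span {z})) = span {c z} \<and>
        (\<forall>v. \<omega> (c z) (frechet_derivative a (at z) v) = 0))"

text \<open>A lift \<open>a0\<close> of the foot and the conormal \<open>b0\<close> of a local
  equation at \<open>a0\<close> span the characteristic line and vary smoothly. The required vectors
  are the components of \<open>z\<close> along them, and \<open>gram_coefficient\<close> makes the
  coefficient smooth.\<close>

lemma ex_decomposition:
  assumes foot: "foot_map \<omega> \<Sigma> U p" and z0: "z0 \<in> cone U"
  obtains N a c where "z0 \<in> N" "N \<subseteq> cone U" "decomposition \<Sigma> p N a c"
proof -
  have U: "U \<subseteq> PV" "open (cone U)"
    using foot by (auto simp: foot_map_def proj_open_def)
  have refl: "reflectable \<omega> \<Sigma> (p (span {z})) (span {z})" if "z \<in> cone U" for z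
    using foot that mem_cone_iff[OF U(1)] by (auto simp: foot_map_def)
  have table: "table \<Sigma>" "\<Sigma> \<subseteq> PV"
    using refl[OF z0] by (auto simp: reflectable_def table_def)
  obtain W0 a0 where W0: "z0 \<in> W0" "local_lift W0 a0 p"
    using foot z0 mem_cone_iff[OF U(1)] by (auto simp: foot_map_def elim: proj_smooth_on_lift)
  have a0: "a0 z \<noteq> 0" "p (span {z}) = span {a0 z}" if "z \<in> W0" for z
    using W0(2) that by (auto simp: local_lift_def)
  have a0_cone: "a0 z \<in> cone \<Sigma>" if "z \<in> W0" "z \<in> cone U" for z
    using refl[OF that(2)] a0[OF that(1)] mem_cone_iff[OF table(2)] by (auto simp: reflectable_def)
  obtain W1 F where F: "a0 z0 \<in> W1" "defining_function \<Sigma> W1 F"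
    using table_defining_function[OF table(1) a0_cone[OF W0(1) z0]] .
  define N where "N = W0 \<inter> a0 -` W1 \<inter> cone U"
  have oW0: "open W0" and sm0: "smooth_on W0 a0" and oW1: "open W1" and smF: "smooth_on W1 F"
    using W0(2) F(2) by (auto simp: local_lift_def defining_function_def)
  have oN: "open N"
    unfolding N_def
    using continuous_open_preimage[OF smooth_on_imp_continuous_on[OF sm0] oW0 oW1] U(2) by blast
  have z0N: "z0 \<in> N"
    using W0(1) F(1) z0 by (simp add: N_def)
  have sma: "smooth_on N a0"
    by (rule smooth_on_subset[OF sm0]) (auto simp: N_def)
  define b0 where "b0 z = conormal F (a0 z)" for z
  have smb: "smooth_on N b0"
    unfolding b0_def
    by (rule smooth_on_compose[OF oN oW1 _ sma smooth_on_conormal[OF F(2)]]) (auto simp: N_def)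
  define \<alpha> where "\<alpha> z = ((z \<bullet> a0 z) * (b0 z \<bullet> b0 z) - (z \<bullet> b0 z) * (a0 z \<bullet> b0 z)) /
      ((a0 z \<bullet> a0 z) * (b0 z \<bullet> b0 z) - (a0 z \<bullet> b0 z) * (a0 z \<bullet> b0 z))" for z
  define a where "a z = \<alpha> z *\<^sub>R a0 z" for z
  define c where "c z = z - a z" for z
  have b0: "contact_point \<omega> \<Sigma> (p (span {z})) = span {b0 z}" "b0 z \<noteq> 0" "\<omega> (a0 z) (b0 z) = 0"
      "span {a0 z} \<noteq> span {b0 z}" if "z \<in> N" for z
  proof -
    have z: "z \<in> W0" "z \<in> cone U" "a0 z \<in> W1"
      using that by (auto simp: N_def)
    note * = contact_point_eq_conormal[OF table(2) F(2) a0_cone[OF z(1,2)] z(3)]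
    show "contact_point \<omega> \<Sigma> (p (span {z})) = span {b0 z}" "b0 z \<noteq> 0" "\<omega> (a0 z) (b0 z) = 0"
      unfolding b0_def a0(2)[OF z(1)] using * by auto
    then show "span {a0 z} \<noteq> span {b0 z}"
      using refl[OF z(2)] a0(2)[OF z(1)] by (auto simp: reflectable_def)
  qed
  have split: "\<exists>y. y \<noteq> 0 \<and> \<alpha> z \<noteq> 0 \<and> z = \<alpha> z *\<^sub>R a0 z + y *\<^sub>R b0 z" if zN: "z \<in> N" for z
  proof -
    have z: "z \<in> W0" "z \<in> cone U" "a0 z \<in> W1"
      using zN by (auto simp: N_def)
    then have z_ne: "z \<noteq> 0"
      by (simp add: cone_def)
    obtain a1 b1 where 1: "isotropic_pair a1 b1" "p (span {z}) = span {a1}"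
      "contact_point \<omega> \<Sigma> (p (span {z})) = span {b1}" "span {z} = span {a1 + b1}"
      using reflectable_lifts[OF refl[OF z(2)]] .
    have "span {a0 z} = span {a1}" "span {b0 z} = span {b1}"
      using 1(2,3) a0(2)[OF z(1)] b0(1)[OF zN] by auto
    then obtain k l where k: "k \<noteq> 0" "a1 = k *\<^sub>R a0 z" and l: "l \<noteq> 0" "b1 = l *\<^sub>R b0 z"
      using span_singleton_eq_iff[OF a0(1)[OF z(1)]] span_singleton_eq_iff[OF b0(2)[OF zN]] by metis
    obtain m where m: "m \<noteq> 0" "a1 + b1 = m *\<^sub>R z"
      using 1(4) span_singleton_eq_iff[OF z_ne] by blast
    have "z = inverse m *\<^sub>R (a1 + b1)"
      using m by simp
    then have eq: "z = (inverse m * k) *\<^sub>R a0 z + (inverse m * l) *\<^sub>R b0 z"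
      using k l by (simp add: scaleR_add_right)
    then have "inverse m * k = \<alpha> z"
      unfolding \<alpha>_def by (rule gram_coefficient(2)[OF a0(1)[OF z(1)] b0(2)[OF zN] b0(4)[OF zN]])
    then show ?thesis
      using eq k(1) l(1) m(1)
      by (intro exI[of _ "inverse m * l"]) (metis inverse_nonzero_iff_nonzero mult_eq_0_iff)
  qed
  have gram: "(a0 z \<bullet> a0 z) * (b0 z \<bullet> b0 z) - (a0 z \<bullet> b0 z) * (a0 z \<bullet> b0 z) \<noteq> 0" if "z \<in> N" for z
    using that by (intro gram_coefficient(1) a0(1) b0(2,4)) (auto simp: N_def)
  have sm\<alpha>: "smooth_on N \<alpha>"
    unfolding \<alpha>_def
    by (intro smooth_on_divide smooth_on_diff smooth_on_mult smooth_on_inner smooth_on_ident sma smb oN gram)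
  have sm: "smooth_on N a" "smooth_on N c"
    unfolding c_def a_def
    by (intro smooth_on_diff smooth_on_scaleR smooth_on_ident sm\<alpha> sma oN)+
  have "z = a z + c z \<and> isotropic_pair (a z) (c z) \<and> p (span {z}) = span {a z} \<and>
        contact_point \<omega> \<Sigma> (p (span {z})) = span {c z} \<and>
        (\<forall>v. \<omega> (c z) (frechet_derivative a (at z) v) = 0)" if zN: "z \<in> N" for z
  proof -
    have z: "z \<in> W0" "z \<in> cone U" "a0 z \<in> W1"
      using zN by (auto simp: N_def)
    obtain y where y: "y \<noteq> 0" "\<alpha> z \<noteq> 0" "z = \<alpha> z *\<^sub>R a0 z + y *\<^sub>R b0 z"
      using split[OF zN] by blast
    have cz: "c z = y *\<^sub>R b0 z"
      using y(3) unfolding c_def a_def by (metis add_diff_cancel_left')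
    have spans: "span {a z} = span {a0 z}" "span {c z} = span {b0 z}"
      using y span_scaleR by (auto simp: cz a_def)
    have pair: "isotropic_pair (a z) (c z)"
      unfolding isotropic_pair_def spans
      using y a0(1)[OF z(1)] b0(2-4)[OF zN] by (simp add: cz a_def \<omega>_simps)
    have d0: "(a0 has_derivative frechet_derivative a0 (at z)) (at z)"
      using smooth_on_has_derivative[OF sma zN] .
    \<comment> \<open>The foot stays on the table, so \<open>F\<close> composed with
      \<open>a0\<close> is constantly zero; its derivative says that \<open>a0\<close> moves
      tangentially.\<close>
    have "((\<lambda>y. F (a0 y)) has_derivative
        (\<lambda>v. frechet_derivative F (at (a0 z)) (frechet_derivative a0 (at z) v))) (at z)"
      using has_derivative_compose[OF d0 smooth_on_has_derivative[OF smF z(3)]] .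
    then have "((\<lambda>y. 0) has_derivative
        (\<lambda>v. frechet_derivative F (at (a0 z)) (frechet_derivative a0 (at z) v))) (at z)"
    proof (rule has_derivative_transform_within_open[OF _ oN zN])
      show "F (a0 y) = 0" if "y \<in> N" for y
        using that a0_cone[of y] F(2) by (auto simp: N_def defining_function_def)
    qed
    then have "(\<lambda>v. frechet_derivative F (at (a0 z)) (frechet_derivative a0 (at z) v)) = (\<lambda>v. 0)"
      using has_derivative_unique has_derivative_const by blast
    then have tang: "\<omega> (b0 z) (frechet_derivative a0 (at z) v) = 0" for v
      unfolding b0_def conormal[OF F(2) z(3)] by metis
    \<comment> \<open>Passing from \<open>a0\<close> to its multiple \<open>a\<close> adds only a
      multiple of \<open>a0 z\<close> to the derivative, and this is orthogonal to
      \<open>b0 z\<close>.\<close>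
    have "(a has_derivative (\<lambda>v. \<alpha> z *\<^sub>R frechet_derivative a0 (at z) v +
        frechet_derivative \<alpha> (at z) v *\<^sub>R a0 z)) (at z)"
      unfolding a_def by (rule has_derivative_scaleR[OF smooth_on_has_derivative[OF sm\<alpha> zN] d0])
    then have "frechet_derivative a (at z) v = \<alpha> z *\<^sub>R frechet_derivative a0 (at z) v +
        frechet_derivative \<alpha> (at z) v *\<^sub>R a0 z" for v
      by (rule fun_cong[OF frechet_derivative_at[symmetric]])
    then have "\<omega> (c z) (frechet_derivative a (at z) v) = 0" for v
      using tang[of v] b0(3)[OF zN] skew[of "b0 z" "a0 z"] by (simp add: cz \<omega>_simps)
    then show ?thesis
      using pair spans a0(2)[OF z(1)] b0(1)[OF zN] by (simp add: c_def)
  qed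
  then have "decomposition \<Sigma> p N a c"
    unfolding decomposition_def using oN sm by blast
  moreover have "N \<subseteq> cone U"
    by (auto simp: N_def)
  ultimately show thesis
    using that z0N by blast
qed

text \<open>Since \<open>\<omega> a c\<close>, \<open>\<omega> c (da)\<close> and hence \<open>\<omega> a (dc)\<close> vanish, both \<open>a + c\<close> and \<open>a - c\<close> pull the
  contact form back to \<open>\<omega> a (da) + \<omega> c (dc)\<close>.\<close>

lemma decomposition_contact_form:
  assumes dec: "decomposition \<Sigma> p N a c" and z: "z \<in> N"
  shows "\<omega> (a z - c z) (frechet_derivative (\<lambda>z. a z - c z) (at z) v) = \<omega> z v"
proof -
  have oN: "open N" and sm: "smooth_on N a" "smooth_on N c"
    and tang: "\<omega> (c z) (frechet_derivative a (at z) v) = 0"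
    and sum: "\<And>y. y \<in> N \<Longrightarrow> a y + c y = y"
    and iso: "\<And>y. y \<in> N \<Longrightarrow> \<omega> (a y) (c y) = 0"
    using dec z unfolding decomposition_def isotropic_pair_def by auto
  define A C where "A = frechet_derivative a (at z)" and "C = frechet_derivative c (at z)"
  have dA: "(a has_derivative A) (at z)" and dC: "(c has_derivative C) (at z)"
    using smooth_on_has_derivative[OF _ z] sm unfolding A_def C_def by auto
  have "((\<lambda>y. y) has_derivative (\<lambda>v. A v + C v)) (at z)"
    by (rule has_derivative_transform_within_open[OF has_derivative_add[OF dA dC] oN z]) (rule sum)
  then have "(\<lambda>v. v) = (\<lambda>v. A v + C v)"
    using has_derivative_unique[OF has_derivative_ident] by blast
  then have v: "v = A v + C v" for v
    by (rule fun_cong)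
  have "((\<lambda>y. 0) has_derivative (\<lambda>v. \<omega> (a z) (C v) + \<omega> (A v) (c z))) (at z)"
    by (rule has_derivative_transform_within_open[OF FDERIV[OF dA dC] oN z]) (rule iso)
  then have "(\<lambda>v. \<omega> (a z) (C v) + \<omega> (A v) (c z)) = (\<lambda>v. 0)"
    using has_derivative_unique has_derivative_const by blast
  then have "\<omega> (a z) (C v) + \<omega> (A v) (c z) = 0"
    by (rule fun_cong)
  then have aC: "\<omega> (a z) (C v) = 0"
    using tang skew[of "A v" "c z"] by (simp add: A_def)
  have g: "frechet_derivative (\<lambda>z. a z - c z) (at z) v = A v - C v"
    by (rule fun_cong[OF frechet_derivative_at[OF has_derivative_diff[OF dA dC], symmetric]])
  have "\<omega> z v = \<omega> (a z + c z) (A v + C v)"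
    using v sum[OF z] by metis
  then show ?thesis
    unfolding g using tang aC by (simp add: \<omega>_simps A_def)
qed

text \<open>The lifts hidden in harmonic conjugacy have a sum proportional to \<open>a + c\<close>.
  Once the factor is divided out, uniqueness of the decomposition identifies them with
  \<open>a\<close> and \<open>c\<close>.\<close>

lemma harmonic_conjugate_span:
  assumes "isotropic_pair a c" "harmonic_conjugates (span {a}) (span {c}) (span {a + c}) L"
  shows "L = span {a - c}"
proof -
  obtain a1 b1 where 1: "span {a} = span {a1}" "span {c} = span {b1}" "span {a + c} = span {a1 + b1}"
    "L = span {a1 - b1}"
    using assms(2) unfolding harmonic_conjugates_def by blast
  have ac: "a + c \<noteq> 0"
    using assms(1) span_neq_combination[of a c 1 1] by (auto simp: isotropic_pair_def)
  then obtain k where k: "k \<noteq> 0" "a1 + b1 = k *\<^sub>R (a + c)"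
    using 1(3) span_singleton_eq_iff by blast
  have spans: "span {inverse k *\<^sub>R a1} = span {a1}" "span {inverse k *\<^sub>R b1} = span {b1}"
    "span {inverse k *\<^sub>R (a1 - b1)} = span {a1 - b1}"
    using k(1) by (simp_all add: span_scaleR)
  have sum: "a + c = inverse k *\<^sub>R a1 + inverse k *\<^sub>R b1"
    using k by (simp flip: scaleR_add_right)
  have "inverse k *\<^sub>R a1 = a" "inverse k *\<^sub>R b1 = c"
    by (rule isotropic_decomposition_unique[OF assms(1) _ _ sum]; simp only: 1 spans)+
  then have "a - c = inverse k *\<^sub>R (a1 - b1)"
    by (simp add: scaleR_diff_right)
  then show ?thesis
    using spans(3) 1(4) by (simp only:)
qed

lemma outer_rule_lift:
  assumes R: "outer_contact_billiard_rule \<omega> R" and foot: "foot_map \<omega> \<Sigma> U p"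
    and dec: "decomposition \<Sigma> p N a c" "N \<subseteq> cone U"
  shows "local_lift N (\<lambda>z. a z - c z) (induced_map \<omega> R \<Sigma> p)"
  unfolding local_lift_def
proof (intro conjI ballI)
  show oN: "open N" and "0 \<notin> N"
    using dec by (auto simp: decomposition_def cone_def)
  show "smooth_on N (\<lambda>z. a z - c z)"
    using dec(1) oN by (intro smooth_on_diff) (auto simp: decomposition_def)
  fix z assume z: "z \<in> N"
  have U: "U \<subseteq> PV"
    using foot by (simp add: foot_map_def proj_open_def)
  have d: "z = a z + c z" "isotropic_pair (a z) (c z)" "p (span {z}) = span {a z}"
    "contact_point \<omega> \<Sigma> (p (span {z})) = span {c z}"
    using dec(1) z by (auto simp: decomposition_def)
  show "a z - c z \<noteq> 0"
    using d(2) by (auto simp: isotropic_pair_def)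
  have "span {z} \<in> U"
    using z dec(2) mem_cone_iff[OF U] by blast
  then have "reflectable \<omega> \<Sigma> (p (span {z})) (span {z})"
    using foot by (simp add: foot_map_def)
  then have "harmonic_conjugates (p (span {z})) (contact_point \<omega> \<Sigma> (p (span {z}))) (span {z})
      (induced_map \<omega> R \<Sigma> p (span {z}))"
    using R unfolding outer_contact_billiard_rule_def induced_map_def by blast
  then have "harmonic_conjugates (span {a z}) (span {c z}) (span {a z + c z})
      (induced_map \<omega> R \<Sigma> p (span {z}))"
    using d(1) by (simp only: d(4)) (simp only: d(3) flip: d(1))
  then show "induced_map \<omega> R \<Sigma> p (span {z}) = span {a z - c z}"
    by (rule harmonic_conjugate_span[OF d(2)])
qed

text \<open>The lift of the foot need not be homogeneous, but the condition that the components add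
  up to \<open>z\<close> forces degree one. This is what lets a local inverse on vectors descend to
  lines.\<close>

lemma decomposition_homogeneous:
  assumes dec: "decomposition \<Sigma> p N a c" and z: "z \<in> N" "k *\<^sub>R z \<in> N" "k \<noteq> 0"
  shows "a (k *\<^sub>R z) = k *\<^sub>R a z" "c (k *\<^sub>R z) = k *\<^sub>R c z"
proof -
  have d: "y = a y + c y" "isotropic_pair (a y) (c y)" "p (span {y}) = span {a y}"
    "contact_point \<omega> \<Sigma> (p (span {y})) = span {c y}" if "y \<in> N" for y
    using dec that by (auto simp: decomposition_def)
  have kz: "span {k *\<^sub>R z} = span {z}"
    by (rule span_scaleR[OF z(3)])
  have pair: "isotropic_pair (k *\<^sub>R a z) (k *\<^sub>R c z)"
    using d(2)[OF z(1)] z(3) by (simp add: isotropic_pair_def \<omega>_simps span_scaleR)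
  have "span {k *\<^sub>R a z} = span {a z}"
    by (rule span_scaleR[OF z(3)])
  also have "\<dots> = span {a (k *\<^sub>R z)}"
    using d(3)[OF z(1)] d(3)[OF z(2)] kz by metis
  finally have 1: "span {k *\<^sub>R a z} = span {a (k *\<^sub>R z)}" .
  have "span {k *\<^sub>R c z} = span {c z}"
    by (rule span_scaleR[OF z(3)])
  also have "\<dots> = span {c (k *\<^sub>R z)}"
    using d(4)[OF z(1)] d(4)[OF z(2)] kz by metis
  finally have 2: "span {k *\<^sub>R c z} = span {c (k *\<^sub>R z)}" .
  have 3: "k *\<^sub>R a z + k *\<^sub>R c z = a (k *\<^sub>R z) + c (k *\<^sub>R z)"
    using d(1)[OF z(1)] d(1)[OF z(2)] by (metis scaleR_add_right)
  show "a (k *\<^sub>R z) = k *\<^sub>R a z" "c (k *\<^sub>R z) = k *\<^sub>R c z"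
    by (rule isotropic_decomposition_unique[OF pair 1 2 3])+
qed

text \<open>Local invertibility on vectors is not yet local invertibility on lines: independent
  vectors might have proportional images. Homogeneity allows images to be normalised to an affine
  hyperplane, where proportional vectors coincide.\<close>

lemma outer_rule_local_diffeo:
  assumes R: "outer_contact_billiard_rule \<omega> R" and foot: "foot_map \<omega> \<Sigma> U p"
  shows "local_diffeo_on U (induced_map \<omega> R \<Sigma> p)"
  unfolding local_diffeo_on_def
proof (intro conjI ballI)
  define T where "T = induced_map \<omega> R \<Sigma> p"
  show oU: "proj_open U"
    using foot by (simp add: foot_map_def)
  then have U: "U \<subseteq> PV"
    by (simp add: proj_open_def)
  fix L assume L: "L \<in> U"
  then obtain z0 where z0: "z0 \<noteq> 0" "L = span {z0}"
    using U PV_iff by blast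
  then have z0U: "z0 \<in> cone U"
    using L mem_cone_iff[OF U] by simp
  obtain N a c where N: "z0 \<in> N" "N \<subseteq> cone U" "decomposition \<Sigma> p N a c"
    using ex_decomposition[OF foot z0U] .
  define g where "g z = a z - c z" for z
  have lift: "local_lift N g T"
    using outer_rule_lift[OF R foot N(3,2)] unfolding g_def T_def .
  have oN: "open N" and smg: "smooth_on N g" and gT: "\<And>z. z \<in> N \<Longrightarrow> T (span {z}) = span {g z}"
    and g0: "\<And>z. z \<in> N \<Longrightarrow> g z \<noteq> 0"
    using lift by (auto simp: local_lift_def)
  have sympl: "\<omega> (frechet_derivative g (at z) u) (frechet_derivative g (at z) v) = \<omega> u v"
    if "z \<in> N" for z u v
    using derivative_symplectic[OF oN smg _ that] decomposition_contact_form[OF N(3)]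
    unfolding g_def by blast
  have "linear (frechet_derivative g (at z0))"
    by (rule has_derivative_linear[OF smooth_on_has_derivative[OF smg N(1)]])
  moreover have "u = 0" if "frechet_derivative g (at z0) u = 0" for u
    using sympl[OF N(1), of u] that by (intro nondegenerate) simp
  ultimately have inj: "inj (frechet_derivative g (at z0))"
    by (simp add: linear_injective_0)
  obtain N1 V h where NV: "open N1" "N1 \<subseteq> N" "z0 \<in> N1" "open V" "g z0 \<in> V" "homeomorphism N1 V g h"
    "\<And>y. y \<in> V \<Longrightarrow> (h has_derivative inv (frechet_derivative g (at (h y)))) (at y)"
    "\<And>y. y \<in> V \<Longrightarrow> bij (frechet_derivative g (at (h y)))"
    using smooth_local_inverse[OF oN smg N(1) inj] by blast
  have smh: "smooth_on V h"
    using NV sympl by (intro smooth_on_symplectic_inverse[OF NV(1,4) smooth_on_subset[OF smg NV(2)] NV(6)]) auto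
  have hg: "h (g z) = z" "g z \<in> V" if "z \<in> N1" for z
    using NV(6) that by (auto simp: homeomorphism_def)
  have gh: "g (h y) = y" "h y \<in> N1" if "y \<in> V" for y
    using NV(6) that by (auto simp: homeomorphism_def)
  define m where "m = g z0"
  have m: "m \<bullet> m \<noteq> 0"
    using g0[OF N(1)] by (simp add: m_def)
  \<comment> \<open>Rescaling by \<open>s z\<close> moves the image of \<open>z\<close> to the
    hyperplane of vectors y with y \<bullet> m = m \<bullet> m. The set \<open>B\<close> below keeps
    both \<open>z\<close> and its rescaling in the region where \<open>h\<close> inverts
    \<open>g\<close>.\<close>
  define s where "s z = (m \<bullet> m) / (g z \<bullet> m)" for z
  define \<rho> where "\<rho> z = s z *\<^sub>R z" for z
  define N2 where "N2 = N1 \<inter> (\<lambda>z. g z \<bullet> m) -` (- {0})"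
  have cg: "continuous_on N1 g"
    using NV(6) by (simp add: homeomorphism_def)
  have oN2: "open N2"
    unfolding N2_def
    by (rule continuous_open_preimage[OF continuous_on_inner[OF cg continuous_on_const] NV(1)])
      (rule open_Compl[OF closed_singleton])
  define B where "B = N2 \<inter> \<rho> -` N1"
  have c\<rho>: "continuous_on N2 \<rho>"
    unfolding \<rho>_def s_def
    by (intro continuous_on_scaleR continuous_on_divide continuous_on_inner continuous_on_const
        continuous_on_id continuous_on_subset[OF cg]) (auto simp: N2_def)
  have oB: "open B"
    unfolding B_def by (rule continuous_open_preimage[OF c\<rho> oN2 NV(1)])
  have z0B: "z0 \<in> B"
    using NV(3) m by (simp add: B_def N2_def \<rho>_def s_def m_def)
  have B: "z \<in> N1" "z \<in> N" "g z \<bullet> m \<noteq> 0" "\<rho> z \<in> N1" "s z \<noteq> 0" if "z \<in> B" for z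
    using that NV(2) m by (auto simp: B_def N2_def s_def)
  have g\<rho>: "g (\<rho> z) = s z *\<^sub>R g z" "g (\<rho> z) \<bullet> m = m \<bullet> m" if "z \<in> B" for z
  proof -
    show 1: "g (\<rho> z) = s z *\<^sub>R g z"
      using decomposition_homogeneous[OF N(3) B(2)[OF that], of "s z"] B[OF that] NV(2)
      unfolding g_def \<rho>_def by (auto simp: scaleR_diff_right)
    show "g (\<rho> z) \<bullet> m = m \<bullet> m"
      unfolding 1 s_def using B(3)[OF that] by simp
  qed
  define U' where "U' = (\<lambda>z. span {z}) ` B"
  have inj_T: "z1 = z2" if L12: "z1 \<in> U'" "z2 \<in> U'" "T z1 = T z2" for z1 z2
  proof -
    obtain y1 y2 where y: "y1 \<in> B" "y2 \<in> B" "z1 = span {y1}" "z2 = span {y2}"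
      using L12(1,2) by (auto simp: U'_def)
    have spans: "span {g (\<rho> y1)} = span {g y1}" "span {g (\<rho> y2)} = span {g y2}"
      by (simp_all only: g\<rho>(1)[OF y(1)] g\<rho>(1)[OF y(2)] span_scaleR[OF B(5)[OF y(1)]]
          span_scaleR[OF B(5)[OF y(2)]])
    have "span {g y1} = span {g y2}"
      using L12(3) gT[OF B(2)[OF y(1)]] gT[OF B(2)[OF y(2)]] by (simp only: y(3,4))
    then have "span {g (\<rho> y1)} = span {g (\<rho> y2)}"
      using spans by (simp only:)
    moreover have "g (\<rho> y1) \<noteq> 0"
      using g\<rho>(2)[OF y(1)] m by auto
    ultimately obtain k where k: "g (\<rho> y2) = k *\<^sub>R g (\<rho> y1)"
      using span_singleton_eq_iff by blast
    then have "m \<bullet> m = k * (m \<bullet> m)"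
      using g\<rho>(2)[OF y(1)] g\<rho>(2)[OF y(2)] by simp
    then have "g (\<rho> y2) = g (\<rho> y1)"
      using k m by simp
    then have "\<rho> y2 = \<rho> y1"
      using hg(1) B(4) y(1,2) by metis
    moreover have "span {\<rho> y1} = z1" "span {\<rho> y2} = z2"
      by (simp_all only: \<rho>_def y(3,4) span_scaleR[OF B(5)[OF y(1)]] span_scaleR[OF B(5)[OF y(2)]])
    ultimately show ?thesis
      by simp
  qed
  then have injU': "inj_on T U'"
    by (rule inj_onI)
  define V' where "V' = g ` B"
  have BN1: "B \<subseteq> N1"
    using B(1) by blast
  have "V' = V \<inter> h -` B"
    unfolding V'_def
  proof (intro equalityI subsetI)
    fix y assume "y \<in> V \<inter> h -` B"
    then show "y \<in> g ` B"
      using gh(1)[of y] by force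
  qed (use hg BN1 in auto)
  then have oV': "open V'"
    using continuous_open_preimage[OF smooth_on_imp_continuous_on[OF smh] NV(4) oB] by simp
  have V'0: "0 \<notin> V'"
    using g0 B(2) by (auto simp: V'_def)
  have B0: "0 \<notin> B"
    using B(2) N(2) by (auto simp: cone_def)
  have TU': "T ` U' = (\<lambda>y. span {y}) ` V'"
    unfolding U'_def V'_def image_image using gT B(2) by (intro image_cong) auto
  have liftB: "local_lift B g T"
    by (rule local_lift_subset[OF lift oB]) (use B(2) in blast)
  \<comment> \<open>The vector inverse \<open>h\<close> lifts the inverse on lines: it sends
    \<open>g z\<close> back to \<open>z\<close>, and injectivity of \<open>T\<close> on
    \<open>U'\<close> makes \<open>inv_into\<close> select the line of \<open>z\<close>.\<close>
  have liftV': "local_lift V' h (inv_into U' T)"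
    unfolding local_lift_def
  proof (intro conjI ballI)
    show "smooth_on V' h"
      by (rule smooth_on_subset[OF smh]) (use hg BN1 in \<open>auto simp: V'_def\<close>)
    fix y assume "y \<in> V'"
    then obtain z where z: "z \<in> B" "y = g z"
      by (auto simp: V'_def)
    then have h: "h y = z"
      using hg(1) B(1) by simp
    show "h y \<noteq> 0"
      using h z B0 by auto
    have "T (span {z}) = span {y}"
      using gT B(2) z by auto
    moreover have "span {z} \<in> U'"
      using z by (simp add: U'_def)
    ultimately show "inv_into U' T (span {y}) = span {h y}"
      using inv_into_f_f[OF injU', of "span {z}"] h by simp
  qed (use oV' V'0 in auto)
  have "proj_open U'"
    unfolding U'_def by (rule proj_open_span_image[OF oB B0])
  moreover have "L \<in> U'"
    using z0B z0 by (simp add: U'_def)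
  moreover have "U' \<subseteq> U"
    unfolding U'_def using B(2) N(2) mem_cone_iff[OF U] by blast
  moreover have "proj_open (T ` U')"
    unfolding TU' by (rule proj_open_span_image[OF oV' V'0])
  moreover have "proj_smooth_on U' T"
    unfolding proj_smooth_on_def
  proof
    fix M assume "M \<in> U'"
    then obtain z where "z \<in> B" "M = span {z}"
      by (auto simp: U'_def)
    then have "z \<in> B \<inter> M"
      by (simp add: span_base)
    then show "\<exists>W g. W \<inter> M \<noteq> {} \<and> local_lift W g T"
      using liftB by blast
  qed
  moreover have "proj_smooth_on (T ` U') (inv_into U' T)"
    unfolding proj_smooth_on_def TU'
  proof
    fix M assume "M \<in> (\<lambda>y. span {y}) ` V'"
    then obtain y where "y \<in> V'" "M = span {y}"
      by auto
    then have "y \<in> V' \<inter> M"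
      by (simp add: span_base)
    then show "\<exists>W g. W \<inter> M \<noteq> {} \<and> local_lift W g (inv_into U' T)"
      using liftV' by blast
  qed
  moreover have "\<forall>M\<in>U'. inv_into U' T (T M) = M"
    using inv_into_f_f[OF injU'] by blast
  ultimately show "\<exists>U' S. proj_open U' \<and> L \<in> U' \<and> U' \<subseteq> U \<and> proj_open (induced_map \<omega> R \<Sigma> p ` U') \<and>
        proj_smooth_on U' (induced_map \<omega> R \<Sigma> p) \<and>
        proj_smooth_on (induced_map \<omega> R \<Sigma> p ` U') S \<and>
        (\<forall>M\<in>U'. S (induced_map \<omega> R \<Sigma> p M) = M)"
    unfolding T_def[symmetric] by blast
qed

text \<open>Preservation is demanded for every lift. Two lifts differ by a nonvanishing smooth
  factor, which multiplies the pulled-back contact form by its square because a vector is orthogonal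
  to itself.\<close>

lemma outer_rule_preserves_contact:
  assumes R: "outer_contact_billiard_rule \<omega> R" and foot: "foot_map \<omega> \<Sigma> U p"
  shows "preserves_contact \<omega> U (induced_map \<omega> R \<Sigma> p)"
  unfolding preserves_contact_def
proof (intro allI impI; elim conjE)
  fix W f z v
  assume f: "local_lift W f (induced_map \<omega> R \<Sigma> p)" and z: "z \<in> W" "span {z} \<in> U"
  have U: "U \<subseteq> PV"
    using foot by (simp add: foot_map_def proj_open_def)
  have z_ne: "z \<noteq> 0" and oW: "open W" and smf: "smooth_on W f"
    using f z by (auto simp: local_lift_def)
  then have "z \<in> cone U"
    using z mem_cone_iff[OF U] by simp
  then obtain N a c where N: "z \<in> N" "N \<subseteq> cone U" "decomposition \<Sigma> p N a c"
    using ex_decomposition[OF foot] by blast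
  define g where "g z = a z - c z" for z
  have g: "local_lift N g (induced_map \<omega> R \<Sigma> p)"
    using outer_rule_lift[OF R foot N(3,2)] unfolding g_def .
  have oN: "open N" and smg: "smooth_on N g"
    using g by (auto simp: local_lift_def)
  define M where "M = N \<inter> W"
  have M: "open M" "z \<in> M" "smooth_on M f" "smooth_on M g"
    using oN oW N(1) z(1) smooth_on_subset[OF smf] smooth_on_subset[OF smg] by (auto simp: M_def)
  have fg: "g y \<noteq> 0" "f y \<noteq> 0" "span {g y} = span {f y}" if "y \<in> M" for y
    using f g that by (auto simp: local_lift_def M_def)
  \<comment> \<open>The proportionality factor, written with inner products so that it is visibly
    smooth.\<close>
  define \<mu> where "\<mu> y = (f y \<bullet> g y) / (g y \<bullet> g y)" for y
  have sm\<mu>: "smooth_on M \<mu>"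
    unfolding \<mu>_def
    by (intro smooth_on_divide smooth_on_inner M) (use fg in auto)
  have f\<mu>: "\<mu> y *\<^sub>R g y = f y" if y: "y \<in> M" for y
  proof -
    obtain k where "f y = k *\<^sub>R g y"
      using fg[OF y] span_singleton_eq_iff by blast
    then show ?thesis
      using fg(1)[OF y] by (simp add: \<mu>_def)
  qed
  have "((\<lambda>y. \<mu> y *\<^sub>R g y) has_derivative (\<lambda>v. \<mu> z *\<^sub>R frechet_derivative g (at z) v +
      frechet_derivative \<mu> (at z) v *\<^sub>R g z)) (at z)"
    by (rule has_derivative_scaleR[OF smooth_on_has_derivative[OF sm\<mu> M(2)]
          smooth_on_has_derivative[OF M(4,2)]])
  then have "(f has_derivative (\<lambda>v. \<mu> z *\<^sub>R frechet_derivative g (at z) v +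
      frechet_derivative \<mu> (at z) v *\<^sub>R g z)) (at z)"
    by (rule has_derivative_transform_within_open[OF _ M(1,2)]) (rule f\<mu>)
  then have D: "frechet_derivative f (at z) v = \<mu> z *\<^sub>R frechet_derivative g (at z) v +
      frechet_derivative \<mu> (at z) v *\<^sub>R g z"
    by (rule fun_cong[OF frechet_derivative_at[symmetric]])
  have "\<omega> (f z) (frechet_derivative f (at z) v) =
      \<mu> z * \<mu> z * \<omega> (g z) (frechet_derivative g (at z) v)"
    unfolding D f\<mu>[OF M(2), symmetric] by (simp add: \<omega>_simps)
  also have "\<omega> (g z) (frechet_derivative g (at z) v) = \<omega> z v"
    using decomposition_contact_form[OF N(3,1)] unfolding g_def .
  finally have "\<omega> (f z) (frechet_derivative f (at z) v) = 0 \<longleftrightarrow> \<omega> z v = 0"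
    using f\<mu>[OF M(2)] fg(2)[OF M(2)] by auto
  moreover have "induced_map \<omega> R \<Sigma> p (span {z}) = span {f z}"
    using f z(1) by (simp add: local_lift_def)
  ultimately show "frechet_derivative f (at z) v
        \<in> contact_plane \<omega> (induced_map \<omega> R \<Sigma> p (span {z})) \<longleftrightarrow>
      v \<in> contact_plane \<omega> (span {z})"
    by (simp add: mem_contact_plane)
qed

lemma outer_rule_local_contact_transformation:
  assumes "outer_contact_billiard_rule \<omega> R" "foot_map \<omega> \<Sigma> U p"
  shows "local_contact_transformation \<omega> U (induced_map \<omega> R \<Sigma> p)"
  using outer_rule_local_diffeo[OF assms] outer_rule_preserves_contact[OF assms]
  by (simp add: local_contact_transformation_def)

end

lemma square_pos: "x \<noteq> 0 \<Longrightarrow> 0 < x * (x::real)"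
  using not_real_square_gt_zero by blast

text \<open>The Gram determinant vanishes when the lines coincide; it is continuous, and it is
  nonzero at \<open>s\<close>.\<close>

lemma open_span_neq:
  fixes u w :: "real \<Rightarrow> 'a::real_inner"
  assumes "isCont u s" "isCont w s" "u s \<noteq> 0" "w s \<noteq> 0" "span {u s} \<noteq> span {w s}"
  shows "\<forall>\<^sub>F t in nhds s. span {u t} \<noteq> span {w t}"
proof -
  define G where "G t = (u t \<bullet> u t) * (w t \<bullet> w t) - (u t \<bullet> w t) * (u t \<bullet> w t)" for t
  have "isCont G s"
    unfolding G_def by (intro isCont_diff isCont_mult isCont_inner assms(1,2))
  then have "(G \<longlongrightarrow> G s) (nhds s)"
    by (simp add: isCont_def flip: tendsto_at_iff_tendsto_nhds)
  moreover have "G s \<noteq> 0"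
    unfolding G_def by (rule gram_coefficient(1)[OF assms(3-5)])
  ultimately have "\<forall>\<^sub>F t in nhds s. G t \<noteq> 0"
    by (rule tendsto_imp_eventually_ne)
  then show ?thesis
  proof eventually_elim
    case (elim t)
    show ?case
    proof
      assume eq: "span {u t} = span {w t}"
      have "w t \<in> span {u t}"
        unfolding eq by (simp add: span_base)
      then obtain k where "w t = k *\<^sub>R u t"
        unfolding span_singleton by blast
      then show False
        using elim by (simp add: G_def)
    qed
  qed
qed

section \<open>A table of conics\<close>

text \<open>The test table is the quadric cone of the quadratic form \<open>\<omega> (M x) x\<close>, where \<open>M\<close> lies in the
  symplectic Lie algebra and acts on the frame as the nilpotent Jordan block
  \<open>a \<mapsto> b \<mapsto> c \<mapsto> d \<mapsto> 0\<close>. The contact point of \<open>x\<close> is \<open>M x\<close>, and nilpotency makes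
  the foot map explicit.\<close>

locale conic_table = symplectic_space \<omega> for \<omega> :: "'a::euclidean_space \<Rightarrow> 'a \<Rightarrow> real" +
  fixes a b c d :: 'a
  assumes frame: "\<omega> a b = 0" "\<omega> a c = 0" "\<omega> a d = 1" "\<omega> b c = - 1" "\<omega> b d = 0" "\<omega> c d = 0"
begin

lemma frame_simps:
  "\<omega> a b = 0" "\<omega> a c = 0" "\<omega> a d = 1" "\<omega> b c = - 1" "\<omega> b d = 0" "\<omega> c d = 0"
  "\<omega> b a = 0" "\<omega> c a = 0" "\<omega> d a = - 1" "\<omega> c b = 1" "\<omega> d b = 0" "\<omega> d c = 0"
  using frame skew[of b a] skew[of c a] skew[of d a] skew[of c b] skew[of d b] skew[of d c]
  by auto

definition M :: "'a \<Rightarrow> 'a" where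
  "M x = \<omega> x d *\<^sub>R b - \<omega> x c *\<^sub>R c + \<omega> x b *\<^sub>R d"

definition Q :: "'a \<Rightarrow> real" where
  "Q x = \<omega> x c * \<omega> x c - 2 * \<omega> x b * \<omega> x d"

definition \<Sigma> :: "'a set set" where
  "\<Sigma> = (\<lambda>x. span {x}) ` {x. Q x = 0 \<and> \<omega> x d \<noteq> 0}"

definition \<U> :: "'a set set" where
  "\<U> = (\<lambda>z. span {z}) ` {z. Q z > 0 \<and> \<omega> z d \<noteq> 0}"

text \<open>If z = x + t M x with Q x = 0, then Q z is the square of t times
  \<open>\<omega> z d\<close>. Taking the positive root fixes one of two branches; the quotient is
  invariant under scaling of \<open>z\<close>.\<close>

definition position :: "'a \<Rightarrow> real" where
  "position z = sqrt (Q z / (\<omega> z d * \<omega> z d))"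

text \<open>The inverse of 1 + t M applied to \<open>z\<close>, as a Neumann series that stops
  because M^4 = 0.\<close>

definition foot :: "'a \<Rightarrow> 'a" where
  "foot z = z - position z *\<^sub>R M z + position z ^ 2 *\<^sub>R M (M z) - position z ^ 3 *\<^sub>R M (M (M z))"

definition foot_line :: "'a set \<Rightarrow> 'a set" where
  "foot_line L = foot ` L"

lemma M_coords: "\<omega> (M x) d = 0" "\<omega> (M x) c = - \<omega> x d" "\<omega> (M x) b = - \<omega> x c"
  unfolding M_def by (simp_all add: \<omega>_simps frame_simps)

lemma \<omega>_M: "\<omega> (M x) v = \<omega> x c * \<omega> v c - \<omega> x d * \<omega> v b - \<omega> x b * \<omega> v d"
  using skew[of b v] skew[of c v] skew[of d v] unfolding M_def by (simp add: \<omega>_simps)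

lemma Q_scaleR: "Q (k *\<^sub>R x) = k * k * Q x"
  unfolding Q_def by (simp add: \<omega>_simps algebra_simps)

lemma M_scaleR: "M (k *\<^sub>R x) = k *\<^sub>R M x"
  unfolding M_def by (simp add: \<omega>_simps algebra_simps)

lemma M_add: "M (x + y) = M x + M y"
  unfolding M_def by (simp add: \<omega>_simps algebra_simps)

lemma M_M_M: "M (M (M x)) = \<omega> x d *\<^sub>R d"
  unfolding M_def[of "M (M x)"] M_coords by simp

lemma smooth_coord: "open W \<Longrightarrow> smooth_on W (\<lambda>x. \<omega> x u)"
  by (rule smooth_on_bounded_linear[OF _ bounded_linear_left smooth_on_ident])

lemma smooth_Q: "open W \<Longrightarrow> smooth_on W Q"
  unfolding Q_def
  by (intro smooth_on_diff smooth_on_mult smooth_on_const smooth_coord)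

lemma has_derivative_Q: "(Q has_derivative (\<lambda>v. 2 * \<omega> (M x) v)) (at x)"
proof -
  have d: "((\<lambda>x. \<omega> x u) has_derivative (\<lambda>v. \<omega> v u)) (at x)" for u
    by (rule bounded_linear_imp_has_derivative[OF bounded_linear_left])
  have "((\<lambda>x. \<omega> x c * \<omega> x c - 2 * \<omega> x b * \<omega> x d) has_derivative
      (\<lambda>v. (\<omega> x c * \<omega> v c + \<omega> v c * \<omega> x c) -
        (2 * \<omega> x b * \<omega> v d + (2 * \<omega> v b) * \<omega> x d))) (at x)"
    by (intro has_derivative_diff has_derivative_mult has_derivative_mult_right d)
  then show ?thesis
    unfolding Q_def \<omega>_M by (simp add: algebra_simps)
qed

lemma frechet_derivative_Q: "frechet_derivative Q (at x) = (\<lambda>v. 2 * \<omega> (M x) v)"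
  using frechet_derivative_at[OF has_derivative_Q] by simp

lemma open_coord: "open {x. \<omega> x d \<noteq> 0}"
proof -
  have "{x. \<omega> x d \<noteq> 0} = (\<lambda>x. \<omega> x d) -` (- {0})"
    by auto
  moreover have "open ((\<lambda>x. \<omega> x d) -` (- {0}))"
    by (intro open_vimage open_Compl closed_singleton bounded_linear.continuous_on[OF bounded_linear_left]
        continuous_on_id)
  ultimately show ?thesis
    by simp
qed

lemma cone_\<Sigma>: "cone \<Sigma> = {x. Q x = 0 \<and> \<omega> x d \<noteq> 0}"
  unfolding \<Sigma>_def by (rule cone_span_image) (auto simp: Q_scaleR scaleR_left)

lemma cone_\<U>: "cone \<U> = {z. Q z > 0 \<and> \<omega> z d \<noteq> 0}"
  unfolding \<U>_def
  by (rule cone_span_image) (auto simp: Q_scaleR scaleR_left intro: mult_pos_pos square_pos)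

lemma \<Sigma>_subset: "\<Sigma> \<subseteq> PV" and \<U>_subset: "\<U> \<subseteq> PV"
proof -
  have "span {x} \<in> PV" if "\<omega> x d \<noteq> 0" for x
    using that unfolding PV_iff by (intro exI[of _ x]) auto
  then show "\<Sigma> \<subseteq> PV" "\<U> \<subseteq> PV"
    unfolding \<Sigma>_def \<U>_def by blast+
qed

lemma defining_function_Q: "defining_function \<Sigma> {x. \<omega> x d \<noteq> 0} Q"
  unfolding defining_function_def cone_\<Sigma> frechet_derivative_Q
proof (intro conjI ballI)
  fix w assume "w \<in> {x. \<omega> x d \<noteq> 0}"
  then have "2 * \<omega> (M w) c \<noteq> 0"
    by (simp add: M_coords)
  then show "\<exists>v. 2 * \<omega> (M w) v \<noteq> 0"
    by blast
qed (use open_coord smooth_Q[OF open_coord] in auto)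

lemma table_\<Sigma>: "table \<Sigma>"
  unfolding table_def smooth_hypersurface_def
proof (intro conjI ballI)
  fix z assume "z \<in> cone \<Sigma>"
  then have "z \<in> {x. \<omega> x d \<noteq> 0}"
    by (simp add: cone_\<Sigma>)
  then show "\<exists>W (F :: 'a \<Rightarrow> real). open W \<and> z \<in> W \<and> smooth_on W F \<and>
      (\<forall>w\<in>W. \<exists>v. frechet_derivative F (at w) v \<noteq> 0) \<and> cone \<Sigma> \<inter> W = {w \<in> W. F w = 0}"
    using defining_function_Q unfolding defining_function_def by blast
qed (rule \<Sigma>_subset)

lemma contact_point_\<Sigma>:
  assumes "x \<in> cone \<Sigma>"
  shows "contact_point \<omega> \<Sigma> (span {x}) = span {M x}"
proof -
  have x: "x \<in> {x. \<omega> x d \<noteq> 0}"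
    using assms by (simp add: cone_\<Sigma>)
  have "\<omega> (conormal Q x - 2 *\<^sub>R M x) v = 0" for v
    using conormal[OF defining_function_Q x, of v]
    by (simp add: \<omega>_simps frechet_derivative_Q)
  then have "conormal Q x - 2 *\<^sub>R M x = 0"
    by (rule nondegenerate)
  then have "conormal Q x = 2 *\<^sub>R M x"
    by simp
  then show ?thesis
    using contact_point_eq_conormal(1)[OF \<Sigma>_subset defining_function_Q assms x]
    by (simp add: span_scaleR)
qed

lemma isotropic_pair_M:
  assumes "x \<in> cone \<Sigma>"
  shows "isotropic_pair x (M x)"
  unfolding isotropic_pair_def
proof (intro conjI)
  have x: "Q x = 0" "\<omega> x d \<noteq> 0"
    using assms by (auto simp: cone_\<Sigma>)
  show "\<omega> x (M x) = 0"
    using x skew[of x "M x"] \<omega>_M[of x x] by (simp add: Q_def algebra_simps)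
  show "x \<noteq> 0"
    using x(2) by auto
  show Mx: "M x \<noteq> 0"
    using M_coords(2)[of x] x(2) by auto
  show "span {x} \<noteq> span {M x}"
  proof
    assume "span {x} = span {M x}"
    then obtain k where "k \<noteq> 0" "x = k *\<^sub>R M x"
      using span_singleton_eq_iff[OF Mx, of x] by auto
    then have "\<omega> x d = k * \<omega> (M x) d"
      by (metis scaleR_left real_scaleR_def)
    then show False
      using x(2) by (simp add: M_coords)
  qed
qed

lemma reflectable_M:
  assumes "x \<in> cone \<Sigma>" "t \<noteq> 0"
  shows "reflectable \<omega> \<Sigma> (span {x}) (span {x + t *\<^sub>R M x})"
proof -
  have iso: "x \<noteq> 0" "M x \<noteq> 0" "span {x} \<noteq> span {M x}"
    using isotropic_pair_M[OF assms(1)] by (auto simp: isotropic_pair_def)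
  have comb: "\<not> (x + t *\<^sub>R M x = k *\<^sub>R x + l *\<^sub>R M x)" if "k = 0 \<or> l = 0" for k l
    using span_combination_eq[OF iso, of 1 t k l] that assms(2) by auto
  have "x + t *\<^sub>R M x \<noteq> 0"
    using comb[of 0 0] by simp
  moreover have "span {x} \<in> \<Sigma>"
    using assms(1) mem_cone_iff[OF \<Sigma>_subset] by blast
  moreover have "span {x} \<noteq> span {x + t *\<^sub>R M x}"
    using span_singleton_eq_iff[OF iso(1), of "x + t *\<^sub>R M x"] comb[of _ 0] by auto
  moreover have "span {M x} \<noteq> span {x + t *\<^sub>R M x}"
    using span_singleton_eq_iff[OF iso(2), of "x + t *\<^sub>R M x"] comb[of 0] by auto
  moreover have "span {x + t *\<^sub>R M x} \<in> proj_line (span {x}) (span {M x})"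
    unfolding mem_proj_line using comb[of 0 0] by (intro exI[of _ 1] exI[of _ t]) simp
  ultimately show ?thesis
    unfolding reflectable_def char_line_def contact_point_\<Sigma>[OF assms(1)]
    using table_\<Sigma> iso(3) by metis
qed

lemma foot:
  assumes "z \<in> cone \<U>"
  shows "foot z \<in> cone \<Sigma>" "z = foot z + position z *\<^sub>R M (foot z)" "position z > 0"
proof -
  have z: "Q z > 0" "\<omega> z d \<noteq> 0"
    using assms by (auto simp: cone_\<U>)
  define t where "t = position z"
  have pos: "\<omega> z d * \<omega> z d > 0"
    using z(2) by (rule square_pos)
  show "position z > 0"
    using z(1) pos by (simp add: position_def)
  have t: "t * t * (\<omega> z d * \<omega> z d) = Q z"
    using z by (simp add: t_def position_def)
  have f: "foot z = z - t *\<^sub>R M z + t ^ 2 *\<^sub>R M (M z) - t ^ 3 *\<^sub>R M (M (M z))"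
    by (simp add: foot_def t_def)
  have coords: "\<omega> (foot z) d = \<omega> z d" "\<omega> (foot z) c = \<omega> z c + t * \<omega> z d"
    "\<omega> (foot z) b = \<omega> z b + t * \<omega> z c + t ^ 2 * \<omega> z d"
    unfolding f by (simp_all add: \<omega>_simps M_coords)
  \<comment> \<open>The value of \<open>position\<close> is exactly the one for which the right-hand
    side vanishes.\<close>
  have "Q (foot z) = Q z - t * t * (\<omega> z d * \<omega> z d)"
    unfolding Q_def coords by (simp add: algebra_simps power2_eq_square)
  then show "foot z \<in> cone \<Sigma>"
    using t z(2) coords(1) by (simp add: cone_\<Sigma>)
  have M2: "M (M z) = \<omega> z d *\<^sub>R c - \<omega> z c *\<^sub>R d"
    unfolding M_def[of "M z"] M_coords by simp
  have f': "foot z = z - t *\<^sub>R (\<omega> z d *\<^sub>R b - \<omega> z c *\<^sub>R c + \<omega> z b *\<^sub>R d) +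
      t ^ 2 *\<^sub>R (\<omega> z d *\<^sub>R c - \<omega> z c *\<^sub>R d) - t ^ 3 *\<^sub>R \<omega> z d *\<^sub>R d"
    unfolding f M_M_M unfolding M2 unfolding M_def ..
  have Mf: "M (foot z) = \<omega> z d *\<^sub>R b - (\<omega> z c + t * \<omega> z d) *\<^sub>R c +
      (\<omega> z b + t * \<omega> z c + t ^ 2 * \<omega> z d) *\<^sub>R d"
    unfolding M_def[of "foot z"] coords ..
  show "z = foot z + position z *\<^sub>R M (foot z)"
    unfolding t_def[symmetric] Mf unfolding f'
    by (simp add: algebra_simps power2_eq_square power3_eq_cube)
qed

lemma foot_scaleR: "foot (k *\<^sub>R z) = k *\<^sub>R foot z"
proof (cases "k = 0")
  case True
  then show ?thesis
    by (simp add: foot_def M_def)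
next
  case False
  then have "position (k *\<^sub>R z) = position z"
    unfolding position_def Q_scaleR by (simp add: scaleR_left)
  then show ?thesis
    unfolding foot_def M_scaleR by (simp add: algebra_simps)
qed

lemma foot_line: "foot_line (span {z}) = span {foot z}"
  unfolding foot_line_def span_singleton image_image by (simp only: foot_scaleR)

lemma open_cone_\<U>: "open (cone \<U>)"
proof -
  have "cone \<U> = {x. \<omega> x d \<noteq> 0} \<inter> Q -` {0<..}"
    by (auto simp: cone_\<U>)
  then show ?thesis
    using continuous_open_preimage[OF smooth_on_imp_continuous_on[OF smooth_Q[OF open_coord]] open_coord]
    by simp
qed

lemma smooth_M:
  assumes "open W" "smooth_on W f"
  shows "smooth_on W (\<lambda>x. M (f x))"
  unfolding M_def
  by (intro smooth_on_add smooth_on_diff smooth_on_scaleR smooth_on_const assms(1)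
      smooth_on_bounded_linear[OF assms(1) bounded_linear_left assms(2)])

lemma foot_lift: "local_lift (cone \<U>) foot foot_line"
  unfolding local_lift_def
proof (intro conjI ballI)
  have p: "smooth_on (cone \<U>) position"
    unfolding position_def
  proof (intro smooth_on_sqrt smooth_on_divide smooth_on_mult smooth_coord smooth_Q open_cone_\<U>)
    show "Q x / (\<omega> x d * \<omega> x d) > 0" "\<omega> x d * \<omega> x d \<noteq> 0" if "x \<in> cone \<U>" for x
      using that by (auto simp: cone_\<U> intro: divide_pos_pos square_pos)
  qed
  have MM: "smooth_on (cone \<U>) M"
    using smooth_M[OF open_cone_\<U> smooth_on_ident[OF open_cone_\<U>]] .
  show "smooth_on (cone \<U>) foot"
    unfolding foot_def power2_eq_square power3_eq_cube
    by (intro smooth_on_add smooth_on_diff smooth_on_scaleR smooth_on_mult p smooth_M MM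
        smooth_on_ident open_cone_\<U>)
  show "foot z \<noteq> 0" "foot_line (span {z}) = span {foot z}" if "z \<in> cone \<U>" for z
    using foot(1)[OF that] foot_line by (auto simp: cone_def)
qed (use open_cone_\<U> in \<open>auto simp: cone_\<U>\<close>)

lemma foot_map_\<Sigma>: "foot_map \<omega> \<Sigma> \<U> foot_line"
proof -
  note U = \<U>_subset
  have lift: "\<exists>z. z \<in> cone \<U> \<and> L = span {z}" if "L \<in> \<U>" for L
  proof -
    obtain z where "z \<noteq> 0" "L = span {z}"
      using U \<open>L \<in> \<U>\<close> PV_iff by blast
    then show ?thesis
      using \<open>L \<in> \<U>\<close> mem_cone_iff[OF U] by blast
  qed
  show ?thesis
    unfolding foot_map_def
  proof (intro conjI ballI)
    show "proj_open \<U>"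
      unfolding proj_open_def using U open_cone_\<U> by blast
    show "proj_smooth_on \<U> foot_line"
      unfolding proj_smooth_on_def
    proof
      fix L assume "L \<in> \<U>"
      then obtain z where "z \<in> cone \<U>" "L = span {z}"
        using lift by blast
      then have "z \<in> cone \<U> \<inter> L"
        by (simp add: span_base)
      then show "\<exists>W g. W \<inter> L \<noteq> {} \<and> local_lift W g foot_line"
        using foot_lift by blast
    qed
    fix L assume "L \<in> \<U>"
    then obtain z where z: "z \<in> cone \<U>" "L = span {z}"
      using lift by blast
    show "reflectable \<omega> \<Sigma> (foot_line L) L"
      using reflectable_M[OF foot(1)[OF z(1)], of "position z"] foot(2,3)[OF z(1)]
      unfolding z(2) foot_line by simp
  qed
qed

text \<open>In the normalised form \<open>span {a + b}\<close> the point sits at parameter 1, so the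
  rule need only be evaluated there.\<close>

lemma position_one:
  assumes "x \<in> cone \<Sigma>"
  shows "x + M x \<in> cone \<U>" "foot (x + M x) = x"
proof -
  have x: "Q x = 0" "\<omega> x d \<noteq> 0"
    using assms by (auto simp: cone_\<Sigma>)
  have coords: "\<omega> (x + M x) d = \<omega> x d" "\<omega> (x + M x) c = \<omega> x c - \<omega> x d"
    "\<omega> (x + M x) b = \<omega> x b - \<omega> x c"
    by (simp_all add: \<omega>_simps M_coords)
  have "Q (x + M x) = Q x + \<omega> x d * \<omega> x d"
    unfolding Q_def coords by (simp add: algebra_simps)
  then have Q: "Q (x + M x) = \<omega> x d * \<omega> x d"
    using x(1) by simp
  show z: "x + M x \<in> cone \<U>"
    using x(2) square_pos[OF x(2)] unfolding cone_\<U> mem_Collect_eq Q coords by blast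
  have "position (x + M x) = 1"
    using x(2) by (simp add: position_def Q coords)
  then have "foot (x + M x) = (x + M x) - M (x + M x) + M (M (x + M x)) - M (M (M (x + M x)))"
    by (simp add: foot_def)
  also have "\<dots> = x"
  proof -
    have "M (M (M (M x))) = 0"
      using M_M_M[of "M x"] by (simp add: M_coords)
    then show ?thesis
      by (simp add: M_add)
  qed
  finally show "foot (x + M x) = x" .
qed

lemma induced_map_\<Sigma>:
  assumes "x \<in> cone \<Sigma>"
  shows "induced_map \<omega> R \<Sigma> foot_line (span {x + M x}) = R (span {x}) (span {M x}) (span {x + M x})"
  unfolding induced_map_def foot_line position_one(2)[OF assms] contact_point_\<Sigma>[OF assms] ..

text \<open>The coefficients along \<open>a\<close>, \<open>b\<close>, \<open>c\<close> parametrise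
  the conic cut out by \<open>Q\<close>, which forces the quadratic term; \<open>Q\<close> ignores
  the coefficient along \<open>d\<close>, so \<open>w\<close> is free. At time 0 the forms
  \<open>\<omega> x\<close> (dx) and \<open>\<omega> (M x)\<close> (d(M x)) take the values w and -
  y. For y = 0 the vector M x stays at \<open>b\<close>.\<close>

definition curve :: "real \<Rightarrow> real \<Rightarrow> real \<Rightarrow> 'a" where
  "curve y w t = a + (y * t) *\<^sub>R b + ((y * t)\<^sup>2 / 2) *\<^sub>R c + (w * t) *\<^sub>R d"

lemma curve_coords:
  "\<omega> (curve y w t) d = 1" "\<omega> (curve y w t) c = - (y * t)" "\<omega> (curve y w t) b = (y * t)\<^sup>2 / 2"
  unfolding curve_def by (simp_all add: \<omega>_simps frame_simps)

lemma curve_cone: "curve y w t \<in> cone \<Sigma>"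
  by (simp add: cone_\<Sigma> Q_def curve_coords power2_eq_square)

lemma M_curve: "M (curve y w t) = b + (y * t) *\<^sub>R c + ((y * t)\<^sup>2 / 2) *\<^sub>R d"
  unfolding M_def curve_coords by simp

lemma curve_0: "curve y w 0 = a"
  by (simp add: curve_def)

lemma M_a: "M a = b"
  by (simp add: M_def frame_simps)

lemma isCont_curve: "isCont (curve y w) t" "isCont (\<lambda>t. M (curve y w t)) t"
  unfolding M_curve unfolding curve_def by (intro continuous_intros; simp)+

end

section \<open>Rules inducing contact transformations\<close>

locale contact_reflection_rule = symplectic_space \<omega> for \<omega> :: "'a::euclidean_space \<Rightarrow> 'a \<Rightarrow> real" +
  fixes R :: "'a rule"
  assumes reflects: "reflection_rule \<omega> R"
    and induces: "\<And>\<Sigma> U p. table \<Sigma> \<Longrightarrow> foot_map \<omega> \<Sigma> U p \<Longrightarrow>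
      local_contact_transformation \<omega> U (induced_map \<omega> R \<Sigma> p)"

locale contact_reflection_rule_frame = contact_reflection_rule \<omega> R + conic_table \<omega> a b c d
  for \<omega> :: "'a::euclidean_space \<Rightarrow> 'a \<Rightarrow> real" and R a b c d
begin

abbreviation T :: "'a set \<Rightarrow> 'a set" where
  "T \<equiv> induced_map \<omega> R \<Sigma> foot_line"

text \<open>Nothing is known about the regularity of \<open>R\<close> itself. The lifts used below
  come from the hypothesis that the induced map is a local diffeomorphism.\<close>

lemma ex_lift:
  assumes "z \<in> cone \<U>"
  obtains W g where "z \<in> W" "local_lift W g T"
proof -
  have z: "span {z} \<in> \<U>" "z \<noteq> 0"
    using assms mem_cone_iff[OF \<U>_subset] by auto
  have "local_diffeo_on \<U> T"
    using induces[OF table_\<Sigma> foot_map_\<Sigma>] by (simp add: local_contact_transformation_def)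
  then obtain U' where "span {z} \<in> U'" "proj_smooth_on U' T"
    using z(1) unfolding local_diffeo_on_def by blast
  then show thesis
    using z(2) by (auto elim: proj_smooth_on_lift intro: that)
qed

lemma T_mem_line:
  assumes "x \<in> cone \<Sigma>"
  shows "T (span {x + M x}) \<in> proj_line (span {x}) (span {M x})"
proof -
  have "reflectable \<omega> \<Sigma> (span {x}) (span {x + M x})"
    using reflectable_M[OF assms, of 1] by simp
  then have "R (span {x}) (contact_point \<omega> \<Sigma> (span {x})) (span {x + M x}) \<in> char_line \<omega> \<Sigma> (span {x})"
    using reflects unfolding reflection_rule_def by blast
  then show ?thesis
    unfolding char_line_def contact_point_\<Sigma>[OF assms] induced_map_\<Sigma>[OF assms] .
qed

text \<open>Along \<open>z = x + M x\<close> with foot \<open>x\<close> on \<open>curve 1 1\<close> the velocity at \<open>a + b\<close> is in the contact plane,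
  while \<open>\<omega> x (dx)\<close> and \<open>\<omega> (M x) (d(M x))\<close> take the values \<open>1\<close> and \<open>- 1\<close>. An image point
  \<open>\<alpha> x + \<beta> (M x)\<close> pulls the contact form back to \<open>\<alpha>\<^sup>2 - \<beta>\<^sup>2\<close> there.\<close>

lemma dichotomy:
  "R (span {a}) (span {b}) (span {a + b}) = span {a + b} \<or>
   R (span {a}) (span {b}) (span {a + b}) = span {a - b}"
proof -
  define x where "x = curve 1 1"
  define z where "z t = x t + M (x t)" for t
  define v where "v = b + c + d"
  have x: "x t \<in> cone \<Sigma>" for t
    unfolding x_def by (rule curve_cone)
  have x0: "x 0 = a" "M (x 0) = b" "z 0 = a + b"
    by (simp_all add: x_def z_def curve_0 M_a)
  have dx: "(x has_vector_derivative (b + d)) (at 0)"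
    unfolding x_def curve_def has_vector_derivative_def
    by (auto intro!: derivative_eq_intros simp: algebra_simps)
  have dMx: "((\<lambda>t. M (x t)) has_vector_derivative c) (at 0)"
    unfolding x_def M_curve has_vector_derivative_def
    by (auto intro!: derivative_eq_intros simp: algebra_simps)
  have dz: "(z has_vector_derivative v) (at 0)"
    unfolding z_def v_def using has_vector_derivative_add[OF dx dMx] by (simp add: algebra_simps)
  have z: "z t \<in> cone \<U>" for t
    unfolding z_def by (rule position_one(1)[OF x])
  obtain W g where W: "z 0 \<in> W" "local_lift W g T"
    using ex_lift[OF z] .
  then have oW: "open W" and smg: "smooth_on W g"
    and g: "\<And>y. y \<in> W \<Longrightarrow> g y \<noteq> 0 \<and> T (span {y}) = span {g y}"
    by (auto simp: local_lift_def)
  define G where "G t = g (z t)" for t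
  define G' where "G' = frechet_derivative g (at (z 0)) v"
  have "((\<lambda>t. g (z t)) has_derivative (\<lambda>h. frechet_derivative g (at (z 0)) (h *\<^sub>R v))) (at 0)"
    using has_derivative_compose[OF dz[unfolded has_vector_derivative_def]
        smooth_on_has_derivative[OF smg W(1)]] .
  moreover have "frechet_derivative g (at (z 0)) (h *\<^sub>R v) = h *\<^sub>R G'" for h
    unfolding G'_def
    by (rule linear_cmul[OF has_derivative_linear[OF smooth_on_has_derivative[OF smg W(1)]]])
  ultimately have dG: "(G has_vector_derivative G') (at 0)"
    unfolding G_def has_vector_derivative_def by simp
  have "preserves_contact \<omega> \<U> T"
    using induces[OF table_\<Sigma> foot_map_\<Sigma>] by (simp add: local_contact_transformation_def)
  moreover have "span {z 0} \<in> \<U>"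
    using z mem_cone_iff[OF \<U>_subset] by blast
  ultimately have "G' \<in> contact_plane \<omega> (T (span {z 0})) \<longleftrightarrow> v \<in> contact_plane \<omega> (span {z 0})"
    using W unfolding preserves_contact_def G'_def by blast
  moreover have "\<omega> (z 0) v = 0"
    unfolding x0 v_def by (simp add: \<omega>_simps frame_simps)
  ultimately have form: "\<omega> (G 0) G' = 0"
    using g[OF W(1)] by (simp add: mem_contact_plane G_def)
  \<comment> \<open>Coefficients of the image along \<open>x t\<close> and M (x t), read off by
    pairing with \<open>d\<close> and \<open>c\<close>. As linear expressions in \<open>G t\<close>,
    with one factor t, they are differentiable at 0.\<close>
  define \<alpha> where "\<alpha> t = \<omega> (G t) d" for t
  define \<beta> where "\<beta> t = - \<omega> (G t) c - t * \<alpha> t" for t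
  have eq: "G t = \<alpha> t *\<^sub>R x t + \<beta> t *\<^sub>R M (x t)" if t: "z t \<in> W" for t
  proof -
    have "span {G t} \<in> proj_line (span {x t}) (span {M (x t)})"
      using T_mem_line[OF x] g[OF t] unfolding G_def z_def by metis
    then obtain k l where kl: "span {G t} = span {k *\<^sub>R x t + l *\<^sub>R M (x t)}"
      unfolding mem_proj_line by blast
    have "G t \<in> span {k *\<^sub>R x t + l *\<^sub>R M (x t)}"
      unfolding kl[symmetric] by (simp add: span_base)
    then obtain m where m: "G t = m *\<^sub>R (k *\<^sub>R x t + l *\<^sub>R M (x t))"
      unfolding span_singleton by blast
    have coords: "\<omega> (x t) d = 1" "\<omega> (x t) c = - t" "\<omega> (M (x t)) d = 0" "\<omega> (M (x t)) c = - 1"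
      by (simp_all add: M_coords x_def curve_coords)
    have \<alpha>: "\<alpha> t = m * k"
      by (simp add: \<alpha>_def m \<omega>_simps coords)
    have \<beta>: "\<beta> t = m * l"
      by (simp add: \<beta>_def \<alpha>) (simp add: m \<omega>_simps coords algebra_simps)
    show ?thesis
      unfolding \<alpha> \<beta> m by (simp add: scaleR_add_right)
  qed
  define \<alpha>' where "\<alpha>' = \<omega> G' d"
  define \<beta>' where "\<beta>' = - \<omega> G' c - \<alpha> 0"
  have d\<alpha>: "(\<alpha> has_vector_derivative \<alpha>') (at 0)"
    unfolding \<alpha>_def \<alpha>'_def
    by (rule bounded_linear.has_vector_derivative[OF bounded_linear_left dG])
  have "((\<lambda>t. - \<omega> (G t) c) has_vector_derivative - \<omega> G' c) (at 0)"
    by (rule has_vector_derivative_minus[OF bounded_linear.has_vector_derivative[OF bounded_linear_left dG]])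
  moreover have "((\<lambda>t. t * \<alpha> t) has_vector_derivative \<alpha> 0) (at 0)"
    using has_vector_derivative_mult[OF has_vector_derivative_id[of "at 0"] d\<alpha>] by simp
  ultimately have d\<beta>: "(\<beta> has_vector_derivative \<beta>') (at 0)"
    unfolding \<beta>_def \<beta>'_def by (rule has_vector_derivative_diff)
  have dsum: "((\<lambda>t. \<alpha> t *\<^sub>R x t + \<beta> t *\<^sub>R M (x t)) has_vector_derivative
      (\<alpha> 0 *\<^sub>R (b + d) + \<alpha>' *\<^sub>R x 0) + (\<beta> 0 *\<^sub>R c + \<beta>' *\<^sub>R M (x 0))) (at 0)"
    by (intro has_vector_derivative_add has_vector_derivative_scaleR dx dMx
        d\<alpha>[folded has_real_derivative_iff_has_vector_derivative]
        d\<beta>[folded has_real_derivative_iff_has_vector_derivative])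
  have "\<forall>\<^sub>F t in nhds 0. z t \<in> W"
  proof -
    have "isCont z 0"
      using dz has_vector_derivative_continuous by blast
    then have "(z \<longlongrightarrow> z 0) (nhds 0)"
      by (simp add: isCont_def flip: tendsto_at_iff_tendsto_nhds)
    then show ?thesis
      using oW W(1) by (rule topological_tendstoD)
  qed
  then obtain S where S: "open S" "0 \<in> S" "\<And>t. t \<in> S \<Longrightarrow> z t \<in> W"
    unfolding eventually_nhds by blast
  have "(G has_vector_derivative
      (\<alpha> 0 *\<^sub>R (b + d) + \<alpha>' *\<^sub>R x 0) + (\<beta> 0 *\<^sub>R c + \<beta>' *\<^sub>R M (x 0))) (at 0)"
    by (rule has_vector_derivative_transform_within_open[OF dsum S(1,2)]) (rule eq[OF S(3), symmetric])
  then have G': "G' = (\<alpha> 0 *\<^sub>R (b + d) + \<alpha>' *\<^sub>R a) + (\<beta> 0 *\<^sub>R c + \<beta>' *\<^sub>R b)"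
    using vector_derivative_unique_at[OF dG] unfolding x0 M_a by blast
  have G0: "G 0 = \<alpha> 0 *\<^sub>R a + \<beta> 0 *\<^sub>R b"
    using eq[OF W(1)] unfolding x0 M_a .
  have "\<alpha> 0 * \<alpha> 0 - \<beta> 0 * \<beta> 0 = 0"
    using form unfolding G0 G' by (simp add: \<omega>_simps frame_simps algebra_simps)
  then have "\<beta> 0 = \<alpha> 0 \<or> \<beta> 0 = - \<alpha> 0"
    by (metis eq_iff_diff_eq_0 square_eq_iff)
  moreover have G_ne: "G 0 \<noteq> 0"
    using g[OF W(1)] by (simp add: G_def)
  ultimately have "\<alpha> 0 \<noteq> 0" "G 0 = \<alpha> 0 *\<^sub>R (a + b) \<or> G 0 = \<alpha> 0 *\<^sub>R (a - b)"
    unfolding G0 by (auto simp: scaleR_add_right scaleR_diff_right)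
  then have "span {G 0} = span {a + b} \<or> span {G 0} = span {a - b}"
    using span_scaleR[of "\<alpha> 0"] by metis
  moreover have "span {G 0} = R (span {a}) (span {b}) (span {a + b})"
    using g[OF W(1)] induced_map_\<Sigma>[OF x[of 0], of R] unfolding G_def z_def x0(1) M_a by simp
  ultimately show ?thesis
    by simp
qed

end

section \<open>Frames adapted to an isotropic pair\<close>

lemma mem_span_pair: "v \<in> span {a, b} \<longleftrightarrow> (\<exists>x y. v = x *\<^sub>R a + y *\<^sub>R (b::'a::real_vector))"
proof -
  have "span {a, b} = {u + w | u w. u \<in> span {a} \<and> w \<in> span {b}}"
    using span_Un[of "{a}" "{b}"] by (simp add: insert_commute)
  then show ?thesis
    unfolding span_singleton by auto
qed

context symplectic_space
begin

lemma ex_prescribed_insert: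
  assumes "independent B" "v \<notin> span B"
  shows "\<exists>u. \<omega> v u = k \<and> (\<forall>x\<in>B. \<omega> x u = f x)"
proof -
  have "v \<notin> B"
    using assms(2) span_base by blast
  moreover from this have "independent (insert v B)"
    using assms by (simp add: independent_insert)
  ultimately show ?thesis
    using ex_prescribed[of "insert v B" "\<lambda>x. if x = v then k else f x"] by auto
qed

lemma isotropic_pair_independent:
  assumes "isotropic_pair a b"
  shows "independent {a, b}" "a \<noteq> b"
  using assms independent_pairI unfolding isotropic_pair_def by blast+

lemma isotropic_pairI:
  assumes "\<omega> a b = 0" "b \<noteq> 0" "\<omega> a m \<noteq> 0" "\<omega> b m = 0"
  shows "isotropic_pair a b"
  unfolding isotropic_pair_def
proof (intro conjI)
  show "a \<noteq> 0"
    using assms(3) by auto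
  show "span {a} \<noteq> span {b}"
  proof
    assume "span {a} = span {b}"
    then obtain k where "a = k *\<^sub>R b"
      using span_singleton_eq_iff[OF assms(2), of a] by auto
    then show False
      using assms(3,4) by (simp add: scaleR_left)
  qed
qed (use assms in auto)

lemma ex_frame:
  assumes "isotropic_pair a b"
  shows "\<exists>c d. conic_table \<omega> a b c d"
proof -
  have ab: "\<omega> a b = 0"
    using assms by (simp add: isotropic_pair_def)
  note ind = isotropic_pair_independent[OF assms]
  obtain c where c: "\<omega> a c = 0" "\<omega> b c = - 1"
    using ex_prescribed[OF ind(1), of "\<lambda>x. if x = a then 0 else - 1"] ind(2) by auto
  \<comment> \<open>The vector \<open>b\<close> pairs to zero with all of \<open>span {a, b}\<close>
    but to - 1 with \<open>c\<close>. Independence of the three then permits prescribing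
    \<open>d\<close> against all of them.\<close>
  have "c \<notin> span {a, b}"
  proof
    assume "c \<in> span {a, b}"
    then obtain x y where "c = x *\<^sub>R a + y *\<^sub>R b"
      unfolding mem_span_pair by blast
    then show False
      using c(2) ab skew[of b a] by (simp add: \<omega>_simps)
  qed
  then obtain d where "\<omega> c d = 0" "\<omega> a d = 1" "\<omega> b d = 0"
    using ex_prescribed_insert[OF ind(1), of c 0 "\<lambda>x. if x = a then 1 else 0"] ind(2) by auto
  then show ?thesis
    using c ab by (intro exI[of _ c] exI[of _ d]) (unfold_locales; simp)
qed

text \<open>Makes the two alternatives of the dichotomy mutually exclusive.\<close>

lemma isotropic_pair_sum_diff:
  assumes "isotropic_pair a b"
  shows "a + b \<noteq> 0" "a - b \<noteq> 0" "span {a + b} \<noteq> span {a - b}"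
proof -
  have ab: "a \<noteq> 0" "b \<noteq> 0" "span {a} \<noteq> span {b}"
    using assms by (auto simp: isotropic_pair_def)
  show 1: "a + b \<noteq> 0" "a - b \<noteq> 0"
    using span_neq_combination[OF ab, of 1 1] span_neq_combination[OF ab, of 1 "- 1"] by auto
  show "span {a + b} \<noteq> span {a - b}"
  proof
    assume "span {a + b} = span {a - b}"
    then obtain k where "a - b = k *\<^sub>R (a + b)"
      using span_singleton_eq_iff[OF 1(1)] by blast
    then have "1 *\<^sub>R a + (- 1) *\<^sub>R b = k *\<^sub>R a + k *\<^sub>R b"
      by (simp add: scaleR_add_right)
    from span_combination_eq[OF ab this] show False
      by linarith
  qed
qed

end

context contact_reflection_rule
begin

text \<open>A property of the two vectors and not of their lines: rescaling one of them moves the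
  reflected point along the characteristic line.\<close>

definition trivial_at :: "'a \<Rightarrow> 'a \<Rightarrow> bool" where
  "trivial_at a b \<longleftrightarrow> R (span {a}) (span {b}) (span {a + b}) = span {a + b}"

lemma frameI: "conic_table \<omega> a b c d \<Longrightarrow> contact_reflection_rule_frame \<omega> R a b c d"
  by (simp add: contact_reflection_rule_frame_def contact_reflection_rule_axioms)

lemma trivial_or_harmonic:
  assumes "isotropic_pair a b"
  shows "trivial_at a b \<or> R (span {a}) (span {b}) (span {a + b}) = span {a - b}"
proof -
  obtain c d where "conic_table \<omega> a b c d"
    using ex_frame[OF assms] by blast
  then interpret contact_reflection_rule_frame \<omega> R a b c d
    by (rule frameI)
  show ?thesis
    using dichotomy by (simp add: trivial_at_def)
qed

end

context contact_reflection_rule_frame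
begin

text \<open>Near each parameter the image line is spanned by the continuous vector
  \<open>g (z t)\<close>, and distinctness of two such lines is an open condition.\<close>

lemma open_T_neq:
  assumes u: "\<And>t. isCont u t" "\<And>t. u t \<noteq> 0" and z: "\<And>t. isCont z t" "\<And>t. z t \<in> cone \<U>"
  shows "open {t::real. T (span {z t}) \<noteq> span {u t}}"
proof (subst open_subopen, intro ballI)
  fix s assume s: "s \<in> {t. T (span {z t}) \<noteq> span {u t}}"
  obtain W g where W: "z s \<in> W" "local_lift W g T"
    using ex_lift[OF z(2)] .
  then have oW: "open W" and smg: "smooth_on W g"
    and g: "\<And>y. y \<in> W \<Longrightarrow> g y \<noteq> 0 \<and> T (span {y}) = span {g y}"
    by (auto simp: local_lift_def)
  have "isCont g (z s)"
    using smooth_on_imp_continuous_on[OF smg] oW W(1) continuous_on_eq_continuous_at by blast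
  then have "isCont (\<lambda>t. g (z t)) s"
    using isCont_o2[OF z(1)] by blast
  then have "\<forall>\<^sub>F t in nhds s. span {g (z t)} \<noteq> span {u t}"
    using u g[OF W(1)] s by (intro open_span_neq) auto
  moreover have "(z \<longlongrightarrow> z s) (nhds s)"
    using z(1)[of s] by (simp add: isCont_def flip: tendsto_at_iff_tendsto_nhds)
  then have "\<forall>\<^sub>F t in nhds s. z t \<in> W"
    using oW W(1) by (rule topological_tendstoD)
  ultimately have "\<forall>\<^sub>F t in nhds s. T (span {z t}) \<noteq> span {u t}"
    by eventually_elim (use g in auto)
  then show "\<exists>S. open S \<and> s \<in> S \<and> S \<subseteq> {t. T (span {z t}) \<noteq> span {u t}}"
    unfolding eventually_nhds by blast
qed

text \<open>Along the curve the image is one of two distinct continuous families of points.\<close>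

lemma trivial_at_curve: "trivial_at (curve y w t) (M (curve y w t)) \<longleftrightarrow> trivial_at a b"
proof -
  define x where "x = curve y w"
  define H where "H = {t. trivial_at (x t) (M (x t))}"
  have x: "x t \<in> cone \<Sigma>" for t
    unfolding x_def by (rule curve_cone)
  have cont: "isCont (\<lambda>t. x t + M (x t)) t" "isCont (\<lambda>t. x t - M (x t)) t" for t
    unfolding x_def by (intro isCont_add isCont_diff isCont_curve)+
  note sd = isotropic_pair_sum_diff[OF isotropic_pair_M[OF x]]
  have "- H = {t. T (span {x t + M (x t)}) \<noteq> span {x t + M (x t)}}"
    unfolding H_def trivial_at_def induced_map_\<Sigma>[OF x] by auto
  then have "open (- H)"
    using open_T_neq[OF cont(1) sd(1) cont(1) position_one(1)[OF x]] by simp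
  then have "closed H"
    by (simp add: closed_def)
  \<comment> \<open>By the dichotomy, being trivial amounts to differing from the harmonic
    conjugate. Thus \<open>H\<close> and its complement are both given by inequality of lines, which
    is open.\<close>
  moreover have "H = {t. T (span {x t + M (x t)}) \<noteq> span {x t - M (x t)}}"
  proof (intro set_eqI iffI)
    fix t assume "t \<in> H"
    then show "t \<in> {t. T (span {x t + M (x t)}) \<noteq> span {x t - M (x t)}}"
      using sd(3)[of t] unfolding H_def trivial_at_def mem_Collect_eq induced_map_\<Sigma>[OF x] by simp
  next
    fix t assume "t \<in> {t. T (span {x t + M (x t)}) \<noteq> span {x t - M (x t)}}"
    then show "t \<in> H"
      using trivial_or_harmonic[OF isotropic_pair_M[OF x[of t]]]
      unfolding H_def mem_Collect_eq induced_map_\<Sigma>[OF x] by blast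
  qed
  then have "open H"
    using open_T_neq[OF cont(2) sd(2) cont(1) position_one(1)[OF x]] by simp
  ultimately have "H = {} \<or> H = UNIV"
    using clopen by blast
  then have "t \<in> H \<longleftrightarrow> 0 \<in> H"
    by auto
  then show ?thesis
    by (simp add: H_def x_def curve_0 M_a)
qed

end

section \<open>Joining isotropic pairs by curves on test tables\<close>

context contact_reflection_rule
begin

text \<open>With y = 0 the curve is the straight line a + t w d, along which the second vector stays
  \<open>b\<close>. It reaches \<open>a'\<close> at time 1 once \<open>d\<close> is the difference
  divided by w, and \<open>\<omega> a d = 1\<close> forces w = \<open>\<omega> a a'\<close>.\<close>

lemma trivial_at_change_first_generic:
  assumes "isotropic_pair a b" "\<omega> a' b = 0" "\<omega> a a' \<noteq> 0"
  shows "trivial_at a' b \<longleftrightarrow> trivial_at a b"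
proof -
  define w where "w = \<omega> a a'"
  define d where "d = (1 / w) *\<^sub>R (a' - a)"
  have w: "w \<noteq> 0"
    using assms(3) by (simp add: w_def)
  have ab: "\<omega> a b = 0"
    using assms(1) by (simp add: isotropic_pair_def)
  have d: "\<omega> a d = 1" "\<omega> b d = 0"
    using w ab assms(2) skew[of b a] skew[of b a'] by (simp_all add: d_def \<omega>_simps w_def)
  note ind = isotropic_pair_independent[OF assms(1)]
  have "d \<notin> span {a, b}"
  proof
    assume "d \<in> span {a, b}"
    then obtain x y where "d = x *\<^sub>R a + y *\<^sub>R b"
      unfolding mem_span_pair by blast
    then show False
      using d(1) ab by (simp add: \<omega>_simps)
  qed
  then obtain c where "\<omega> d c = 0" "\<omega> a c = 0" "\<omega> b c = - 1"
    using ex_prescribed_insert[OF ind(1), of d 0 "\<lambda>x. if x = a then 0 else - 1"] ind(2) by auto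
  then have "conic_table \<omega> a b c d"
    using ab d skew[of c d] by unfold_locales auto
  then interpret contact_reflection_rule_frame \<omega> R a b c d
    by (rule frameI)
  have "w *\<^sub>R d = a' - a"
    using w by (simp add: d_def)
  then have a': "a' = curve 0 w 1"
    by (simp add: curve_def)
  have "M (curve 0 w 1) = b"
    by (simp add: M_curve)
  then show ?thesis
    using trivial_at_curve[of 0 w 1] by (simp add: a')
qed

text \<open>If \<open>\<omega> a a'\<close> vanishes there is no direct line; the detour passes
  through a vector \<open>m\<close> orthogonal to \<open>b\<close> but to neither \<open>a\<close>
  nor \<open>a'\<close>.\<close>

lemma trivial_at_change_first:
  assumes a: "isotropic_pair a b" and a': "isotropic_pair a' b"
  shows "trivial_at a' b \<longleftrightarrow> trivial_at a b"
proof -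
  have b: "b \<noteq> 0" and ab: "\<omega> a b = 0" "\<omega> a' b = 0" "a \<noteq> 0"
    using a a' by (auto simp: isotropic_pair_def)
  have "\<exists>m. \<omega> a m \<noteq> 0 \<and> \<omega> a' m \<noteq> 0 \<and> \<omega> b m = 0"
  proof (cases "a' \<in> span {a, b}")
    case True
    then obtain k l where kl: "a' = k *\<^sub>R a + l *\<^sub>R b"
      unfolding mem_span_pair by blast
    have "k \<noteq> 0"
    proof
      assume "k = 0"
      then have "l \<noteq> 0" "a' = l *\<^sub>R b"
        using a' kl by (auto simp: isotropic_pair_def)
      then show False
        using a' span_scaleR[of l b] by (simp add: isotropic_pair_def)
    qed
    moreover obtain m where "\<omega> a m = 1" "\<omega> b m = 0"
      using ex_prescribed[OF isotropic_pair_independent(1)[OF a], of "\<lambda>x. if x = a then 1 else 0"]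
        isotropic_pair_independent(2)[OF a] by auto
    ultimately show ?thesis
      unfolding kl by (intro exI[of _ m]) (simp add: \<omega>_simps)
  next
    case False
    then obtain m where "\<omega> a' m = 1" "\<omega> a m = 1" "\<omega> b m = 0"
      using ex_prescribed_insert[OF isotropic_pair_independent(1)[OF a], of a' 1 "\<lambda>x. if x = a then 1 else 0"]
        isotropic_pair_independent(2)[OF a] by auto
    then show ?thesis
      by (intro exI[of _ m]) simp
  qed
  then obtain m where m: "\<omega> a m \<noteq> 0" "\<omega> a' m \<noteq> 0" "\<omega> b m = 0"
    by blast
  have mb: "\<omega> m b = 0"
    using m(3) skew[of m b] by simp
  have "\<omega> m a' \<noteq> 0" "\<omega> m a \<noteq> 0"
    using m skew[of m a'] skew[of m a] by auto
  have "isotropic_pair m b"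
    using mb b \<open>\<omega> m a \<noteq> 0\<close> ab(1) skew[of b a] by (intro isotropic_pairI[of m b a]) auto
  then show ?thesis
    using trivial_at_change_first_generic[OF a mb m(1)]
      trivial_at_change_first_generic[OF _ ab(2) \<open>\<omega> m a' \<noteq> 0\<close>] by simp
qed

text \<open>Solves b + y c + (y^2 / 2) d = b' for a frame, so that the second vector reaches
  \<open>b'\<close> at time 1. The first vectors are produced by the construction;
  \<open>trivial_at_change_first\<close> exchanges them afterwards.\<close>

lemma trivial_at_change_second_generic:
  assumes pair: "isotropic_pair a0 b0" and bb': "\<omega> b b' \<noteq> 0"
  obtains a a' where "isotropic_pair a b" "isotropic_pair a' b'" "trivial_at a' b' \<longleftrightarrow> trivial_at a b"
proof -
  \<comment> \<open>Forced by pairing the equation for \<open>b'\<close> with \<open>b\<close>,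
    since \<open>\<omega> b c = - 1\<close> and \<open>\<omega> b d = 0\<close>.\<close>
  define y where "y = - \<omega> b b'"
  have y: "y \<noteq> 0"
    using bb' by (simp add: y_def)
  have b: "b \<noteq> 0" "b' \<noteq> 0"
    using bb' by auto
  have "span {b} \<noteq> span {b'}"
  proof
    assume "span {b} = span {b'}"
    then obtain k where "b' = k *\<^sub>R b"
      using span_singleton_eq_iff[OF b(1)] by blast
    then show False
      using bb' by (simp add: scaleR_right)
  qed
  note ind = independent_pairI[OF b this]
  obtain c0 d0 where "conic_table \<omega> a0 b0 c0 d0"
    using ex_frame[OF pair] by blast
  then interpret f: conic_table \<omega> a0 b0 c0 d0 .
  \<comment> \<open>The frame of the given pair contains three independent vectors, so the plane of
    \<open>b\<close> and \<open>b'\<close> is not the whole space.\<close>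
  have "\<exists>e. e \<notin> span {b, b'}"
  proof (rule ccontr)
    assume all: "\<nexists>e. e \<notin> span {b, b'}"
    have "c0 \<notin> span {a0, b0}"
    proof
      assume "c0 \<in> span {a0, b0}"
      then obtain x y where "c0 = x *\<^sub>R a0 + y *\<^sub>R b0"
        unfolding mem_span_pair by blast
      moreover have "\<omega> b0 c0 = - 1" "\<omega> b0 a0 = 0"
        by (simp_all add: f.frame_simps)
      ultimately show False
        by (simp add: \<omega>_simps)
    qed
    moreover from this have "c0 \<notin> {a0, b0}"
      using span_base by blast
    ultimately have 3: "independent {c0, a0, b0}" "card {c0, a0, b0} = 3"
      using isotropic_pair_independent[OF pair] by (auto simp: independent_insert)
    have "{c0, a0, b0} \<subseteq> span {b, b'}"
      using all by blast
    then have "card {c0, a0, b0} \<le> card {b, b'}"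
      using independent_span_bound[of "{b, b'}" "{c0, a0, b0}"] 3(1) by blast
    moreover have "card {b, b'} \<le> 2"
      by (simp add: card_insert_if)
    ultimately show False
      using 3(2) by simp
  qed
  then obtain e where e: "e \<notin> span {b, b'}"
    by blast
  \<comment> \<open>The projection of \<open>e\<close> to the \<open>\<omega>\<close>-complement of
    the plane of \<open>b\<close> and \<open>b'\<close>.\<close>
  define d where "d = e + (\<omega> b e / y) *\<^sub>R b' - (\<omega> b' e / y) *\<^sub>R b"
  have b'b: "\<omega> b b' = - y" "\<omega> b' b = y"
    using skew[of b' b] by (simp_all add: y_def)
  have bd: "\<omega> b d = 0" "\<omega> b' d = 0"
    using y by (simp_all add: d_def \<omega>_simps b'b)
  have d: "d \<notin> span {b, b'}"
  proof
    assume d: "d \<in> span {b, b'}"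
    have "e = d - (\<omega> b e / y) *\<^sub>R b' + (\<omega> b' e / y) *\<^sub>R b"
      by (simp add: d_def)
    also have "\<dots> \<in> span {b, b'}"
      using d by (intro span_add span_diff span_scale) (auto intro: span_base)
    finally show False
      using e by simp
  qed
  define c where "c = (1 / y) *\<^sub>R (b' - b - (y\<^sup>2 / 2) *\<^sub>R d)"
  have bc: "\<omega> b c = - 1" "\<omega> c d = 0"
    using y by (simp_all add: c_def \<omega>_simps b'b bd)
  \<comment> \<open>The value prescribed against \<open>b'\<close> is the one that yields
    \<open>\<omega> a c = 0\<close>.\<close>
  obtain a where da: "\<omega> d a = - 1" and ba: "\<omega> b a = 0" "\<omega> b' a = - (y\<^sup>2 / 2)"
    using ex_prescribed_insert[OF ind(1) d, of "- 1" "\<lambda>x. if x = b then 0 else - (y\<^sup>2 / 2)"] ind(2)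
    by auto
  have a: "\<omega> a b = 0" "\<omega> a d = 1" "\<omega> a b' = y\<^sup>2 / 2"
    using ba da skew[of a b] skew[of a d] skew[of a b'] by auto
  have ac: "\<omega> a c = 0"
    using a by (simp add: c_def \<omega>_simps)
  have "conic_table \<omega> a b c d"
    using a(1,2) ac bc bd(1) by unfold_locales auto
  then interpret contact_reflection_rule_frame \<omega> R a b c d
    by (rule frameI)
  have "y *\<^sub>R c = b' - b - (y\<^sup>2 / 2) *\<^sub>R d"
    using y by (simp add: c_def)
  then have b': "M (curve y 0 1) = b'"
    by (simp add: M_curve)
  show thesis
  proof (rule that[of a "curve y 0 1"])
    show "isotropic_pair a b"
      using isotropic_pair_M[OF curve_cone[of 0 0 0]] by (simp add: curve_0 M_a)
    show "isotropic_pair (curve y 0 1) b'"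
      using isotropic_pair_M[OF curve_cone[of y 0 1]] by (simp add: b')
    show "trivial_at (curve y 0 1) b' \<longleftrightarrow> trivial_at a b"
      using trivial_at_curve[of y 0 1] by (simp add: b')
  qed
qed

lemma trivial_at_change_generic:
  assumes "isotropic_pair a b" "isotropic_pair a' b'" "\<omega> b b' \<noteq> 0"
  shows "trivial_at a' b' \<longleftrightarrow> trivial_at a b"
proof -
  obtain a1 a1' where 1: "isotropic_pair a1 b" "isotropic_pair a1' b'"
    "trivial_at a1' b' \<longleftrightarrow> trivial_at a1 b"
    using trivial_at_change_second_generic[OF assms(1,3)] .
  show ?thesis
    using 1(3) trivial_at_change_first[OF assms(1) 1(1)] trivial_at_change_first[OF assms(2) 1(2)]
    by simp
qed

text \<open>Two nonzero vectors always admit a common \<open>m\<close> pairing nontrivially with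
  both, so two generic moves suffice.\<close>

lemma trivial_at_iff:
  assumes a: "isotropic_pair a b" and a': "isotropic_pair a' b'"
  shows "trivial_at a' b' \<longleftrightarrow> trivial_at a b"
proof -
  have b: "b \<noteq> 0" "b' \<noteq> 0"
    using a a' by (auto simp: isotropic_pair_def)
  have "\<exists>m. \<omega> b m \<noteq> 0 \<and> \<omega> b' m \<noteq> 0"
  proof (cases "b' \<in> span {b}")
    case True
    then obtain k where k: "b' = k *\<^sub>R b"
      unfolding span_singleton by blast
    obtain m where "\<omega> b m \<noteq> 0"
      using nondegenerate b(1) by blast
    then show ?thesis
      using b(2) unfolding k by (intro exI[of _ m]) (auto simp: scaleR_left)
  next
    case False
    have "independent {b}"
      using b(1) by simp
    then obtain m where "\<omega> b' m = 1" "\<omega> b m = 1"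
      using ex_prescribed_insert[OF _ False, of 1 "\<lambda>x. 1"] by auto
    then show ?thesis
      by (intro exI[of _ m]) simp
  qed
  then obtain m where m: "\<omega> b m \<noteq> 0" "\<omega> b' m \<noteq> 0"
    by blast
  obtain a1 where a1: "isotropic_pair a1 m"
    using trivial_at_change_second_generic[OF a m(1)] by blast
  show ?thesis
    using trivial_at_change_generic[OF a a1 m(1)] trivial_at_change_generic[OF a' a1 m(2)] by simp
qed

lemma nontrivial_imp_outer:
  assumes "\<not> trivial_rule \<omega> R"
  shows "outer_contact_billiard_rule \<omega> R"
proof -
  obtain \<Sigma> q Z where nt: "reflectable \<omega> \<Sigma> q Z" "R q (contact_point \<omega> \<Sigma> q) Z \<noteq> Z"
    using assms unfolding trivial_rule_def by blast
  obtain a0 b0 where 0: "isotropic_pair a0 b0" "q = span {a0}" "contact_point \<omega> \<Sigma> q = span {b0}"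
    "Z = span {a0 + b0}"
    using reflectable_lifts[OF nt(1)] .
  then have nt0: "\<not> trivial_at a0 b0"
    using nt(2) unfolding trivial_at_def by metis
  show ?thesis
    unfolding outer_contact_billiard_rule_def
  proof (intro allI impI)
    fix \<Sigma> q Z assume "reflectable \<omega> \<Sigma> q Z"
    then obtain a b where ab: "isotropic_pair a b" "q = span {a}" "contact_point \<omega> \<Sigma> q = span {b}"
      "Z = span {a + b}"
      by (rule reflectable_lifts)
    have "R (span {a}) (span {b}) (span {a + b}) = span {a - b}"
      using trivial_or_harmonic[OF ab(1)] trivial_at_iff[OF 0(1) ab(1)] nt0 by blast
    then have "harmonic_conjugates (span {a}) (span {b}) (span {a + b})
        (R (span {a}) (span {b}) (span {a + b}))"
      using ab(1) unfolding harmonic_conjugates_def isotropic_pair_def by metis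
    then show "harmonic_conjugates q (contact_point \<omega> \<Sigma> q) Z (R q (contact_point \<omega> \<Sigma> q) Z)"
      unfolding ab(3) unfolding ab(2,4) .
  qed
qed

end

theorem corollary5p1:
  fixes \<omega> :: "'a::euclidean_space \<Rightarrow> 'a \<Rightarrow> real" and R :: "'a rule"
  assumes "symplectic_form \<omega>"
    and "reflection_rule \<omega> R"
    and "\<not> trivial_rule \<omega> R"
  shows "(\<forall>\<Sigma> U p. table \<Sigma> \<and> foot_map \<omega> \<Sigma> U p \<longrightarrow>
            local_contact_transformation \<omega> U (induced_map \<omega> R \<Sigma> p))
         \<longleftrightarrow> outer_contact_billiard_rule \<omega> R"
proof
  interpret symplectic_space \<omega>
    using assms(1) by unfold_locales
  show "outer_contact_billiard_rule \<omega> R"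
    if H: "\<forall>\<Sigma> U p. table \<Sigma> \<and> foot_map \<omega> \<Sigma> U p \<longrightarrow>
      local_contact_transformation \<omega> U (induced_map \<omega> R \<Sigma> p)"
  proof -
    interpret contact_reflection_rule \<omega> R
      using assms(2) H by unfold_locales auto
    show ?thesis
      using nontrivial_imp_outer[OF assms(3)] .
  qed
  show "\<forall>\<Sigma> U p. table \<Sigma> \<and> foot_map \<omega> \<Sigma> U p \<longrightarrow>
      local_contact_transformation \<omega> U (induced_map \<omega> R \<Sigma> p)"
    if "outer_contact_billiard_rule \<omega> R"
    using outer_rule_local_contact_transformation[OF that] by blast
qed

end
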